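(* For a two-player stage game $G$, we have $G\notin\mathcal{G}_{LS}^{m,p}$ and $G\in\mathcal{G}_{LS}^{m,m}$ if and only if one of the following holds: (1) $|V_1^{m,p}|=0$, $|V_2^{m,p}|=0$, and $\mathcal{C}^{m,m}(G)$ holds; (2) $|V_1^{m,p}|=1$, $|V_2^{m,p}|=1$, and $\mathcal{C}^{m,m}(G)$ holds; (3) $|V_1^{m,p}|>1$, $|V_2^{m,p}|=1$, $\mathcal{C}^{m,p}(G)$ does not hold, and $\mathcal{C}^{m,m}(G)$ holds; (4) $|V_1^{m,p}|=1$, $|V_2^{m,p}|>1$, $\mathcal{C}^{m,p}(G)$ does not hold, and $\mathcal{C}^{m,m}(G)$ holds.
   Context: A two-player stage game $G$ has finite nonempty action sets $A_1,A_2$ and payoffs $u_1,u_2:A_1\times A_2\to\mathbb{R}$, extended to mixed strategies by expectation; $S_{\sigma_1}$ is the support of $\sigma_1$; best response means maximizing expected payoff against the opponent's strategy. $G(T)$ is the $T$-round repetition with realized actions observed each round and payoffs the expected sum of stage payoffs; an SPE of $G(T)$ is a strategy profile whose continuation after every history of length $k<T$ is a Nash equilibrium of $G(T-k)$. Regimes: pure-pure ($p,p$): both players restricted to actions (in the stage game and in every round, including deviations); mixed-pure ($m,p$): player 1 may mix, player 2 uses only actions; mixed-mixed ($m,m$): both may mix. For regime $r$, $\mathrm{Nash}^r(G)$ is the set of stage-game profiles available in $r$ from which no player can profitably deviate unilaterally to a strategy available in $r$, and $V_i^r=\{u_i(\sigma):\sigma\in\mathrm{Nash}^r(G)\}$.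 Locally suboptimal behavior occurs in an SPE $\mu$ of $G(T)$ (regime $r$) if for some history $h$ of length $k<T$, $(\mu_1(h),\mu_2(h))\notin\mathrm{Nash}^r(G)$. $\mathcal{G}_{LS}^r$ is the set of stage games $G$ for which there exist $T\ge1$ and an SPE of $G(T)$ in regime $r$ in which locally suboptimal behavior occurs. Condition $\mathcal{C}^{m,p}(G)$ holds iff one of: (i) $|V_1^{m,p}|>1$, $|V_2^{m,p}|>1$, and some $(\hat\sigma_1,\hat a_2)\in\Delta A_1\times A_2$ is not in $\mathrm{Nash}^{m,p}(G)$; (ii) $|V_1^{m,p}|>1$, $|V_2^{m,p}|=1$, and there exist $\hat\sigma_1\in\Delta A_1$, $a_1'\in A_1$, $\hat a_2\in A_2$ with $u_1(\hat\sigma_1,\hat a_2)<u_1(a_1',\hat a_2)$, $\hat a_2$ a best response to $\hat\sigma_1$, and, if $|S_{\hat\sigma_1}|>1$, with $D=\{u_1(\sigma)-u_1(\sigma'):\sigma,\sigma'\in\mathrm{Nash}^{m,p}(G)\}$, some $a\in S_{\hat\sigma_1}$ such that for every $a'\in S_{\hat\sigma_1}\setminus\{a\}$ there are an integer $n\ge0$ and $d_1,\dots,d_n\in D$ with $u_1(a,\hat a_2)-u_1(a',\hat a_2)=\sum_{k=1}^n d_k$; (iii) $|V_1^{m,p}|=1$, $|V_2^{m,p}|>1$, and there exist $\hat\sigma_1\in\Delta A_1$, $\hat a_2,a_2'\in A_2$ with $u_2(\hat\sigma_1,\hat a_2)<u_2(\hat\sigma_1,a_2')$ and $\hat\sigma_1$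 a best response to $\hat a_2$. Condition $\mathcal{C}^{m,m}(G)$ holds iff one of: (i) $|V_1^{m,m}|>1$, $|V_2^{m,m}|>1$, and some $(\hat\sigma_1,\hat\sigma_2)\in\Delta A_1\times\Delta A_2$ is not in $\mathrm{Nash}^{m,m}(G)$; (ii) $|V_1^{m,m}|>1$, $|V_2^{m,m}|=1$, and there exist $\hat\sigma_1,\hat\sigma_2$, $a_1'\in A_1$ with $u_1(\hat\sigma_1,\hat\sigma_2)<u_1(a_1',\hat\sigma_2)$ and $\hat\sigma_2$ a best response to $\hat\sigma_1$; (iii) $|V_1^{m,m}|=1$, $|V_2^{m,m}|>1$, and there exist $\hat\sigma_1,\hat\sigma_2$, $a_2'\in A_2$ with $u_2(\hat\sigma_1,\hat\sigma_2)<u_2(\hat\sigma_1,a_2')$ and $\hat\sigma_1$ a best response to $\hat\sigma_2$. *)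

theory Defs
  imports "HOL-Probability.Probability_Mass_Function"
begin

text \<open>A two-player stage game is given by two payoff functions on finite (nonempty)
  action types. Mixed strategies are probability mass functions; a pure action a is
  identified with return_pmf a.\<close>

datatype regime = PP | MP | MM

definition avail1 :: "regime \<Rightarrow> 'a pmf set" where
  "avail1 r = (if r = PP then range return_pmf else UNIV)"

definition avail2 :: "regime \<Rightarrow> 'b pmf set" where
  "avail2 r = (if r = MM then UNIV else range return_pmf)"

definition eu :: "('a::finite \<Rightarrow> 'b::finite \<Rightarrow> real) \<Rightarrow> 'a pmf \<Rightarrow> 'b pmf \<Rightarrow> real" where
  "eu u s1 s2 = (\<Sum>a\<in>UNIV. \<Sum>b\<in>UNIV. pmf s1 a * pmf s2 b * u a b)"

definition nash :: "regime \<Rightarrow> ('a::finite \<Rightarrow> 'b::finite \<Rightarrow> real) \<Rightarrow> ('a \<Rightarrow> 'b \<Rightarrow> real)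
    \<Rightarrow> ('a pmf \<times> 'b pmf) set" where
  "nash r u1 u2 = {(s1, s2). s1 \<in> avail1 r \<and> s2 \<in> avail2 r \<and>
      (\<forall>t\<in>avail1 r. eu u1 t s2 \<le> eu u1 s1 s2) \<and>
      (\<forall>t\<in>avail2 r. eu u2 s1 t \<le> eu u2 s1 s2)}"

definition V1 :: "regime \<Rightarrow> ('a::finite \<Rightarrow> 'b::finite \<Rightarrow> real) \<Rightarrow> ('a \<Rightarrow> 'b \<Rightarrow> real) \<Rightarrow> real set" where
  "V1 r u1 u2 = (\<lambda>(s1, s2). eu u1 s1 s2) ` nash r u1 u2"

definition V2 :: "regime \<Rightarrow> ('a::finite \<Rightarrow> 'b::finite \<Rightarrow> real) \<Rightarrow> ('a \<Rightarrow> 'b \<Rightarrow> real) \<Rightarrow> real set" where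
  "V2 r u1 u2 = (\<lambda>(s1, s2). eu u2 s1 s2) ` nash r u1 u2"

text \<open>|V| > 1 (V may be infinite, so this is not phrased via card).\<close>
definition several :: "real set \<Rightarrow> bool" where
  "several V \<longleftrightarrow> (\<exists>x\<in>V. \<exists>y\<in>V. x \<noteq> y)"

fun rval :: "('a::finite \<Rightarrow> 'b::finite \<Rightarrow> real) \<Rightarrow> nat \<Rightarrow> (('a \<times> 'b) list \<Rightarrow> 'a pmf)
    \<Rightarrow> (('a \<times> 'b) list \<Rightarrow> 'b pmf) \<Rightarrow> ('a \<times> 'b) list \<Rightarrow> real" where
  "rval u 0 f g h = 0"
| "rval u (Suc n) f g h =
     (\<Sum>a\<in>UNIV. \<Sum>b\<in>UNIV. pmf (f h) a * pmf (g h) b * (u a b + rval u n f g (h @ [(a, b)])))"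

definition strat1 :: "regime \<Rightarrow> (('a \<times> 'b) list \<Rightarrow> 'a pmf) \<Rightarrow> bool" where
  "strat1 r f \<longleftrightarrow> (\<forall>h. f h \<in> avail1 r)"

definition strat2 :: "regime \<Rightarrow> (('a \<times> 'b) list \<Rightarrow> 'b pmf) \<Rightarrow> bool" where
  "strat2 r g \<longleftrightarrow> (\<forall>h. g h \<in> avail2 r)"

definition cont_nash :: "regime \<Rightarrow> ('a::finite \<Rightarrow> 'b::finite \<Rightarrow> real) \<Rightarrow> ('a \<Rightarrow> 'b \<Rightarrow> real) \<Rightarrow> nat
    \<Rightarrow> (('a \<times> 'b) list \<Rightarrow> 'a pmf) \<Rightarrow> (('a \<times> 'b) list \<Rightarrow> 'b pmf) \<Rightarrow> ('a \<times> 'b) list \<Rightarrow> bool" where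
  "cont_nash r u1 u2 n f g h \<longleftrightarrow>
     (\<forall>f'. strat1 r f' \<longrightarrow> rval u1 n f' g h \<le> rval u1 n f g h) \<and>
     (\<forall>g'. strat2 r g' \<longrightarrow> rval u2 n f g' h \<le> rval u2 n f g h)"

definition spe :: "regime \<Rightarrow> ('a::finite \<Rightarrow> 'b::finite \<Rightarrow> real) \<Rightarrow> ('a \<Rightarrow> 'b \<Rightarrow> real) \<Rightarrow> nat
    \<Rightarrow> (('a \<times> 'b) list \<Rightarrow> 'a pmf) \<Rightarrow> (('a \<times> 'b) list \<Rightarrow> 'b pmf) \<Rightarrow> bool" where
  "spe r u1 u2 T f g \<longleftrightarrow> strat1 r f \<and> strat2 r g \<and>
     (\<forall>h. length h < T \<longrightarrow> cont_nash r u1 u2 (T - length h) f g h)"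

definition GLS :: "regime \<Rightarrow> ('a::finite \<Rightarrow> 'b::finite \<Rightarrow> real) \<Rightarrow> ('a \<Rightarrow> 'b \<Rightarrow> real) \<Rightarrow> bool" where
  "GLS r u1 u2 \<longleftrightarrow> (\<exists>T\<ge>1. \<exists>f g. spe r u1 u2 T f g \<and>
       (\<exists>h. length h < T \<and> (f h, g h) \<notin> nash r u1 u2))"

definition Cmp :: "('a::finite \<Rightarrow> 'b::finite \<Rightarrow> real) \<Rightarrow> ('a \<Rightarrow> 'b \<Rightarrow> real) \<Rightarrow> bool" where
  "Cmp u1 u2 \<longleftrightarrow>
    (several (V1 MP u1 u2) \<and> several (V2 MP u1 u2) \<and>
       (\<exists>s1 a2. (s1, return_pmf a2) \<notin> nash MP u1 u2))
  \<or> (several (V1 MP u1 u2) \<and> card (V2 MP u1 u2) = 1 \<and>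
       (\<exists>s1 a1' a2. eu u1 s1 (return_pmf a2) < eu u1 (return_pmf a1') (return_pmf a2) \<and>
          (\<forall>b. eu u2 s1 (return_pmf b) \<le> eu u2 s1 (return_pmf a2)) \<and>
          (card (set_pmf s1) > 1 \<longrightarrow>
             (\<exists>a\<in>set_pmf s1. \<forall>a'\<in>set_pmf s1 - {a}.
                \<exists>ds. set ds \<subseteq> {eu u1 (fst p) (snd p) - eu u1 (fst q) (snd q) | p q.
                                     p \<in> nash MP u1 u2 \<and> q \<in> nash MP u1 u2} \<and>
                     u1 a a2 - u1 a' a2 = sum_list ds))))
  \<or> (card (V1 MP u1 u2) = 1 \<and> several (V2 MP u1 u2) \<and>
       (\<exists>s1 a2 a2'. eu u2 s1 (return_pmf a2) < eu u2 s1 (return_pmf a2') \<and>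
          (\<forall>t. eu u1 t (return_pmf a2) \<le> eu u1 s1 (return_pmf a2))))"

definition Cmm :: "('a::finite \<Rightarrow> 'b::finite \<Rightarrow> real) \<Rightarrow> ('a \<Rightarrow> 'b \<Rightarrow> real) \<Rightarrow> bool" where
  "Cmm u1 u2 \<longleftrightarrow>
    (several (V1 MM u1 u2) \<and> several (V2 MM u1 u2) \<and>
       (\<exists>s1 s2. (s1, s2) \<notin> nash MM u1 u2))
  \<or> (several (V1 MM u1 u2) \<and> card (V2 MM u1 u2) = 1 \<and>
       (\<exists>s1 s2 a1'. eu u1 s1 s2 < eu u1 (return_pmf a1') s2 \<and>
          (\<forall>t. eu u2 s1 t \<le> eu u2 s1 s2)))
  \<or> (card (V1 MM u1 u2) = 1 \<and> several (V2 MM u1 u2) \<and>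
       (\<exists>s1 s2 a2'. eu u2 s1 s2 < eu u2 s1 (return_pmf a2') \<and>
          (\<forall>t. eu u1 t s2 \<le> eu u1 s1 s2)))"

end

(* Up to continuation values, an SPE is a strategy profile whose behaviour after each history is
   an equilibrium of the stage game with the continuation values added to the payoffs.

   Necessity: after a longest history with suboptimal behaviour only stage equilibria are played.
   A player with a single equilibrium payoff then faces constant continuation values and so best
   responds at that history. In the mixed-pure regime the support of player 1's action is kept
   indifferent by differences of sums of equally many equilibrium payoffs.

   Sufficiency: play a suitable profile in the first round and then a sequence of stage equilibria
   that depends on the first-round actions only. The delicate case is mixed-mixed with a single
   equilibrium payoff v of player 2 and several of player 1. If player 2 has a best response to some
   pure action a of player 1 against which a is not optimal, punishing player 1's deviations from a
   works. Otherwise v is the maximum of u2 in each row,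
   and no column is constantly v; rewarding player 1 heavily for cells with u2 < v gives a game
   whose equilibria (they exist by Brouwer's theorem) never give player 2 the payoff v. *)

theory Submission
  imports Defs "HOL-Analysis.Brouwer_Fixpoint"
begin

section \<open>Expected payoffs and reduction to pure deviations\<close>

lemma sum_pmf_UNIV [simp]: "(\<Sum>a\<in>UNIV. pmf (s :: 'a::finite pmf) a) = 1"
  by (simp add: sum_pmf_eq_1)

lemma pmf_avg_const: "(\<Sum>a\<in>UNIV. pmf (s :: 'a::finite pmf) a * c) = c"
  by (simp flip: sum_distrib_right)

lemma pmf_avg_le:
  fixes s :: "'a::finite pmf"
  assumes "\<And>a. a \<in> set_pmf s \<Longrightarrow> f a \<le> c"
  shows "(\<Sum>a\<in>UNIV. pmf s a * f a) \<le> c"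
proof -
  have "pmf s a * f a \<le> pmf s a * c" for a
    using assms[of a] by (cases "a \<in> set_pmf s") (auto simp: set_pmf_iff intro: mult_left_mono)
  then have "(\<Sum>a\<in>UNIV. pmf s a * f a) \<le> (\<Sum>a\<in>UNIV. pmf s a * c)"
    by (intro sum_mono) auto
  then show ?thesis by (simp add: pmf_avg_const)
qed

lemma pmf_avg_ge:
  fixes s :: "'a::finite pmf"
  assumes "\<And>a. a \<in> set_pmf s \<Longrightarrow> c \<le> f a"
  shows "c \<le> (\<Sum>a\<in>UNIV. pmf s a * f a)"
  using pmf_avg_le[of s "\<lambda>a. - f a" "- c"] assms by (simp add: sum_negf)

text \<open>A support point strictly below \<open>c\<close> has positive weight and would pull the
  average strictly below \<open>c\<close>. This is the source of every indifference
  argument.\<close>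

lemma pmf_avg_tight:
  fixes s :: "'a::finite pmf"
  assumes le: "\<And>a. f a \<le> c" and ge: "c \<le> (\<Sum>a\<in>UNIV. pmf s a * f a)" and a: "a \<in> set_pmf s"
  shows "f a = c"
proof (rule ccontr)
  assume "f a \<noteq> c"
  then have "f a < c" using le[of a] by simp
  then have "pmf s a * f a < pmf s a * c"
    using a by (simp add: pmf_positive)
  then have "(\<Sum>a\<in>UNIV. pmf s a * f a) < (\<Sum>a\<in>UNIV. pmf s a * c)"
    by (intro sum_strict_mono_ex1) (auto intro: mult_left_mono le)
  then show False using ge by (simp add: pmf_avg_const)
qed

lemma eu_add: "eu (\<lambda>a b. u a b + w a b) s t = eu u s t + eu w s t"
  by (simp add: eu_def algebra_simps sum.distrib)

lemma eu_avg1: "eu u s t = (\<Sum>a\<in>UNIV. pmf s a * (\<Sum>b\<in>UNIV. pmf t b * u a b))"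
  by (simp add: eu_def sum_distrib_left mult.assoc)

lemma eu_swap: "eu (\<lambda>b a. u a b) t s = eu u s t"
  unfolding eu_def by (subst sum.swap) (simp add: mult.commute mult.left_commute)

lemma eu_const [simp]: "eu (\<lambda>a b. c) s t = c"
  by (simp add: eu_avg1 pmf_avg_const)

lemma sum_pmf_return: "(\<Sum>a\<in>UNIV. pmf (return_pmf (x :: 'a::finite)) a * f a) = f x"
proof -
  have "(\<Sum>a\<in>UNIV. pmf (return_pmf x) a * f a) = (\<Sum>a\<in>UNIV. if a = x then f a else 0)"
    by (rule sum.cong) (auto simp: indicator_def)
  then show ?thesis by simp
qed

lemma eu_return1: "eu u (return_pmf a) t = (\<Sum>b\<in>UNIV. pmf t b * u a b)"
  by (simp add: eu_avg1 sum_pmf_return)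

lemma eu_return2: "eu u s (return_pmf b) = (\<Sum>a\<in>UNIV. pmf s a * u a b)"
  by (simp add: eu_avg1 sum_pmf_return)

lemma eu_return [simp]: "eu u (return_pmf a) (return_pmf b) = u a b"
  by (simp add: eu_return1 sum_pmf_return)

lemma eu_pure1: "eu u s t = (\<Sum>a\<in>UNIV. pmf s a * eu u (return_pmf a) t)"
  by (simp add: eu_return1 eu_avg1)

lemma eu_pure2: "eu u s t = (\<Sum>b\<in>UNIV. pmf t b * eu u s (return_pmf b))"
  using eu_pure1[of "\<lambda>b a. u a b" t s] by (simp only: eu_swap[of u])

lemma eu_mono:
  assumes "\<And>a b. u a b \<le> w a b"
  shows "eu u s t \<le> eu w s t"
  unfolding eu_def by (intro sum_mono mult_left_mono assms) auto

lemma eu_cong_supp: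
  assumes "\<And>a b. a \<in> set_pmf s \<Longrightarrow> b \<in> set_pmf t \<Longrightarrow> u a b = w a b"
  shows "eu u s t = eu w s t"
  unfolding eu_def using assms by (intro sum.cong refl) (auto simp: set_pmf_iff)

lemma eu_tight:
  assumes le: "\<And>a b. u a b \<le> c" and ge: "c \<le> eu u s t"
    and a: "a \<in> set_pmf s" and b: "b \<in> set_pmf t"
  shows "u a b = c"
proof -
  have "eu u (return_pmf a') t \<le> c" for a'
    unfolding eu_return1 by (intro pmf_avg_le le)
  then have "eu u (return_pmf a) t = c"
    using pmf_avg_tight[of "\<lambda>a. eu u (return_pmf a) t" c s a] ge a by (simp flip: eu_pure1)
  then show ?thesis
    using pmf_avg_tight[of "u a" c t b] le b by (simp add: eu_return1)
qed

lemma eu_le_iff_pure1: "(\<forall>t. eu u t s2 \<le> c) \<longleftrightarrow> (\<forall>a. eu u (return_pmf a) s2 \<le> c)"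
proof safe
  fix t assume "\<forall>a. eu u (return_pmf a) s2 \<le> c"
  then show "eu u t s2 \<le> c" by (subst eu_pure1) (rule pmf_avg_le, simp)
qed simp

lemma eu_le_iff_pure2: "(\<forall>t. eu u s1 t \<le> c) \<longleftrightarrow> (\<forall>b. eu u s1 (return_pmf b) \<le> c)"
proof safe
  fix t assume "\<forall>b. eu u s1 (return_pmf b) \<le> c"
  then show "eu u s1 t \<le> c" by (subst eu_pure2) (rule pmf_avg_le, simp)
qed simp

lemma return_in_avail [simp]: "return_pmf a \<in> avail1 r" "return_pmf b \<in> avail2 r"
  by (auto simp: avail1_def avail2_def)

lemma nash_iff_pure:
  "(s1, s2) \<in> nash r u1 u2 \<longleftrightarrow> s1 \<in> avail1 r \<and> s2 \<in> avail2 r \<and>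
     (\<forall>a. eu u1 (return_pmf a) s2 \<le> eu u1 s1 s2) \<and> (\<forall>b. eu u2 s1 (return_pmf b) \<le> eu u2 s1 s2)"
proof -
  have "(\<forall>t\<in>avail1 r. eu u1 t s2 \<le> eu u1 s1 s2) \<longleftrightarrow> (\<forall>a. eu u1 (return_pmf a) s2 \<le> eu u1 s1 s2)"
    using eu_le_iff_pure1[of u1 s2 "eu u1 s1 s2"] by (auto intro: bspec[OF _ return_in_avail(1)])
  moreover have "(\<forall>t\<in>avail2 r. eu u2 s1 t \<le> eu u2 s1 s2) \<longleftrightarrow> (\<forall>b. eu u2 s1 (return_pmf b) \<le> eu u2 s1 s2)"
    using eu_le_iff_pure2[of u2 s1 "eu u2 s1 s2"] by (auto intro: bspec[OF _ return_in_avail(2)])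
  ultimately show ?thesis by (simp add: nash_def)
qed

lemma nash_add_const:
  "nash r (\<lambda>a b. u1 a b + c1) (\<lambda>a b. u2 a b + c2) = nash r u1 u2"
  by (auto simp: nash_iff_pure eu_add)

lemma nash_support1:
  assumes "(s1, s2) \<in> nash r u1 u2" "a \<in> set_pmf s1"
  shows "eu u1 (return_pmf a) s2 = eu u1 s1 s2"
  using assms pmf_avg_tight[of "\<lambda>a. eu u1 (return_pmf a) s2" "eu u1 s1 s2" s1 a]
  by (auto simp: nash_iff_pure simp flip: eu_pure1)

text \<open>The mixed-mixed regime is symmetric in the players, so results about one player can be
  transferred to the other.\<close>

lemma nash_MM_swap:
  "(t, s) \<in> nash MM (\<lambda>b a. u2 a b) (\<lambda>b a. u1 a b) \<longleftrightarrow> (s, t) \<in> nash MM u1 u2"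
  by (auto simp: nash_def avail1_def avail2_def eu_swap[of u1] eu_swap[of u2])


subsection \<open>Existence of a mixed Nash equilibrium\<close>

lemma ex_pmf:
  fixes p :: "'a::finite \<Rightarrow> real"
  assumes "\<And>a. 0 \<le> p a" "sum p UNIV = 1"
  obtains s where "\<And>a. pmf s a = p a"
proof
  show "pmf (embed_pmf p) a = p a" for a
    using assms by (intro pmf_embed_pmf) (auto simp: nn_integral_count_space_finite sum_ennreal)
qed

text \<open>Clearing the denominator makes the gains \<open>max 0 (v i - m)\<close> proportional to
  the weights \<open>p i\<close>. Since \<open>m\<close> is the average of \<open>v\<close>, some
  action of positive weight has no gain, so the factor \<open>G\<close> is zero and with it every
  gain.\<close>

lemma Nash_map_fixed:
  fixes p v :: "'a::finite \<Rightarrow> real"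
  assumes nonneg: "\<And>i. 0 \<le> p i" and sum1: "sum p UNIV = 1"
    and m: "m = (\<Sum>i\<in>UNIV. p i * v i)"
    and fixed: "\<And>i. (p i + max 0 (v i - m)) / (1 + (\<Sum>k\<in>UNIV. max 0 (v k - m))) = p i"
  shows "v i \<le> m"
proof -
  define G where "G = (\<Sum>k\<in>UNIV. max 0 (v k - m))"
  have G0: "0 \<le> G" by (auto simp: G_def intro: sum_nonneg)
  have eq: "max 0 (v i - m) = p i * G" for i
    using fixed[of i] G0 by (simp add: G_def[symmetric] field_simps)
  have "\<exists>i. 0 < p i \<and> v i \<le> m"
  proof (rule ccontr)
    assume "\<not> ?thesis"
    then have gt: "m < v i" if "0 < p i" for i using that by (meson not_le)
    have "\<exists>i. 0 < p i"
    proof (rule ccontr)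
      assume "\<not> ?thesis"
      then have "p i = 0" for i using nonneg[of i] by (metis order_le_less)
      then show False using sum1 by simp
    qed
    then obtain j where j: "0 < p j" by blast
    have "(\<Sum>i\<in>UNIV. p i * m) < (\<Sum>i\<in>UNIV. p i * v i)"
    proof (rule sum_strict_mono_ex1)
      show "\<forall>i\<in>UNIV. p i * m \<le> p i * v i"
        using gt nonneg by (metis less_eq_real_def mult_left_mono mult_zero_left order_refl)
      show "\<exists>i\<in>UNIV. p i * m < p i * v i" using j gt[OF j] by (intro bexI[of _ j]) auto
    qed simp
    then show False using sum1 m by (simp flip: sum_distrib_right)
  qed
  then obtain j where "0 < p j" "v j \<le> m" by blast
  then have "G = 0" using eq[of j] by simp
  then show ?thesis using eq[of i] by simp
qed

text \<open>Brouwer's theorem needs a Euclidean space, so mixed strategies are represented by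
  vectors. Boundedness comes from the l1 norm, which is 1 on the simplex.\<close>

lemma simplex_cart:
  defines "S \<equiv> {x :: real^'n. (\<forall>i. 0 \<le> x $ i) \<and> (\<Sum>i\<in>UNIV. x $ i) = 1}"
  shows "compact S" "convex S" "S \<noteq> {}"
proof -
  have "closed {x :: real^'n. 0 \<le> x $ i}" for i
    by (intro closed_Collect_le continuous_intros)
  moreover have "closed {x :: real^'n. (\<Sum>i\<in>UNIV. x $ i) = 1}"
    by (intro closed_Collect_eq continuous_intros)
  moreover have "S = (\<Inter>i. {x. 0 \<le> x $ i}) \<inter> {x. (\<Sum>i\<in>UNIV. x $ i) = 1}"
    by (auto simp: S_def)
  ultimately have "closed S" by auto
  moreover have "norm x \<le> 1" if "x \<in> S" for x
    using that norm_le_l1_cart[of x] by (simp add: S_def)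
  then have "bounded S" by (auto simp: bounded_iff)
  ultimately show "compact S" by (simp add: compact_eq_bounded_closed)
  show "convex S"
    unfolding convex_def S_def
    by (auto simp: sum.distrib simp flip: sum_distrib_left)
  have "axis undefined 1 \<in> S"
    by (auto simp: S_def axis_def)
  then show "S \<noteq> {}" by blast
qed

lemma nash_MM_nonempty:
  fixes u1 :: "'a::finite \<Rightarrow> 'b::finite \<Rightarrow> real" and u2 :: "'a \<Rightarrow> 'b \<Rightarrow> real"
  shows "nash MM u1 u2 \<noteq> {}"
proof -
  define S where "S = {x :: real^'a. (\<forall>i. 0 \<le> x $ i) \<and> (\<Sum>i\<in>UNIV. x $ i) = 1}"
  define T where "T = {y :: real^'b. (\<forall>i. 0 \<le> y $ i) \<and> (\<Sum>i\<in>UNIV. y $ i) = 1}"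
  define P where "P = (\<lambda>(z :: (real^'a) \<times> (real^'b)) i. \<Sum>j\<in>UNIV. snd z $ j * u1 i j)"
  define Q where "Q = (\<lambda>(z :: (real^'a) \<times> (real^'b)) j. \<Sum>i\<in>UNIV. fst z $ i * u2 i j)"
  define m1 where "m1 = (\<lambda>z. \<Sum>i\<in>UNIV. fst z $ i * P z i)"
  define m2 where "m2 = (\<lambda>z. \<Sum>j\<in>UNIV. snd z $ j * Q z j)"
  \<comment> \<open>Nash's map: each weight is raised by the positive part of the gain of its pure
    action over the current payoff, then all weights are renormalised.\<close>
  define F where "F = (\<lambda>z.
    ((\<chi> i. (fst z $ i + max 0 (P z i - m1 z)) / (1 + (\<Sum>k\<in>UNIV. max 0 (P z k - m1 z)))) :: real^'a,
     (\<chi> j. (snd z $ j + max 0 (Q z j - m2 z)) / (1 + (\<Sum>k\<in>UNIV. max 0 (Q z k - m2 z)))) :: real^'b))"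
  have pos1: "1 + (\<Sum>k\<in>UNIV. max 0 (P z k - m1 z)) > 0" for z
    by (intro add_pos_nonneg sum_nonneg) auto
  have pos2: "1 + (\<Sum>k\<in>UNIV. max 0 (Q z k - m2 z)) > 0" for z
    by (intro add_pos_nonneg sum_nonneg) auto
  have "compact (S \<times> T)" "convex (S \<times> T)" "S \<times> T \<noteq> {}"
    using simplex_cart[where 'n = 'a] simplex_cart[where 'n = 'b]
    by (auto simp: S_def T_def intro: compact_Times convex_Times)
  moreover have "continuous_on (S \<times> T) F"
  proof -
    have "continuous_on (S \<times> T) (\<lambda>z. P z i)" for i
      unfolding P_def by (intro continuous_intros)
    moreover from this have "continuous_on (S \<times> T) m1"
      unfolding m1_def by (intro continuous_intros)
    moreover have "continuous_on (S \<times> T) (\<lambda>z. Q z i)" for i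
      unfolding Q_def by (intro continuous_intros)
    moreover from this have "continuous_on (S \<times> T) m2"
      unfolding m2_def by (intro continuous_intros)
    ultimately show ?thesis
      unfolding F_def
      by (intro continuous_on_Pair continuous_on_vec_lambda continuous_intros)
        (simp_all add: less_imp_neq[OF pos1, symmetric] less_imp_neq[OF pos2, symmetric])
  qed
  moreover have "F \<in> S \<times> T \<rightarrow> S \<times> T"
  proof
    fix z assume "z \<in> S \<times> T"
    then have z: "\<And>i. 0 \<le> fst z $ i" "(\<Sum>i\<in>UNIV. fst z $ i) = 1"
      "\<And>j. 0 \<le> snd z $ j" "(\<Sum>j\<in>UNIV. snd z $ j) = 1"
      by (auto simp: S_def T_def)
    have "fst (F z) \<in> S"
      using z pos1[of z] by (auto simp: S_def F_def sum.distrib simp flip: sum_divide_distrib)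
    moreover have "snd (F z) \<in> T"
      using z pos2[of z] by (auto simp: T_def F_def sum.distrib simp flip: sum_divide_distrib)
    ultimately show "F z \<in> S \<times> T" by (simp add: mem_Times_iff)
  qed
  ultimately obtain z where z: "z \<in> S \<times> T" "F z = z"
    by (rule brouwer)
  then have z': "\<And>i. 0 \<le> fst z $ i" "(\<Sum>i\<in>UNIV. fst z $ i) = 1"
      "\<And>j. 0 \<le> snd z $ j" "(\<Sum>j\<in>UNIV. snd z $ j) = 1"
    by (auto simp: S_def T_def)
  obtain s where s: "\<And>i. pmf s i = fst z $ i" using ex_pmf[of "\<lambda>i. fst z $ i"] z' by auto
  obtain t where t: "\<And>j. pmf t j = snd z $ j" using ex_pmf[of "\<lambda>j. snd z $ j"] z' by auto
  have Ps: "P z i = eu u1 (return_pmf i) t" for i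
    by (simp add: P_def eu_return1 t)
  have Qt: "Q z j = eu u2 s (return_pmf j)" for j
    by (simp add: Q_def eu_return2 s)
  have m: "m1 z = eu u1 s t" "m2 z = eu u2 s t"
    using eu_pure1[of u1 s t] eu_pure2[of u2 s t] by (simp_all add: m1_def m2_def Ps Qt s t)
  have "fst (F z) $ i = fst z $ i" "snd (F z) $ j = snd z $ j" for i j using z by auto
  then have "P z i \<le> m1 z" "Q z j \<le> m2 z" for i j
    using Nash_map_fixed[of "\<lambda>i. fst z $ i" "m1 z" "P z" i] z'
      Nash_map_fixed[of "\<lambda>j. snd z $ j" "m2 z" "Q z" j]
    by (auto simp: F_def m1_def m2_def)
  then have "(s, t) \<in> nash MM u1 u2"
    by (simp add: nash_iff_pure Ps Qt m avail1_def avail2_def)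
  then show ?thesis by blast
qed


subsection \<open>One-shot deviations\<close>

text \<open>Here \<open>n\<close> counts the rounds after the current one, so the game from
  \<open>h\<close> on has \<open>Suc n\<close> rounds.\<close>

abbreviation stage where
  "stage u n f g h \<equiv> (\<lambda>a b. u a b + rval u n f g (h @ [(a, b)]))"

lemma rval_Suc_eu: "rval u (Suc n) f g h = eu (stage u n f g h) (f h) (g h)"
  by (simp add: eu_def)

lemma rval_cong:
  assumes "\<And>k. f (h @ k) = f' (h @ k)" "\<And>k. g (h @ k) = g' (h @ k)"
  shows "rval u n f g h = rval u n f' g' h"
  using assms
proof (induction n arbitrary: h)
  case (Suc n)
  have "rval u n f g (h @ [x]) = rval u n f' g' (h @ [x])" for x
    using Suc.prems by (intro Suc.IH) auto
  then show ?case
    using Suc.prems[of "[]"] by simp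
qed simp

text \<open>The one-shot deviation principle. Deviations at \<open>h\<close> alone give one
  direction. Conversely, induction on the remaining rounds bounds the continuation of a deviation by
  that of the prescribed play, and the stage condition bounds its current move.\<close>

lemma spe_iff_one_shot:
  "spe r u1 u2 T f g \<longleftrightarrow> strat1 r f \<and> strat2 r g \<and>
     (\<forall>h n. length h + Suc n = T \<longrightarrow> (f h, g h) \<in> nash r (stage u1 n f g h) (stage u2 n f g h))"
  (is "?L \<longleftrightarrow> ?R")
proof
  assume L: ?L
  then have st: "strat1 r f" "strat2 r g" by (auto simp: spe_def)
  have "(f h, g h) \<in> nash r (stage u1 n f g h) (stage u2 n f g h)" if n: "length h + Suc n = T" for h n
  proof -
    have "T - length h = Suc n" "length h < T" using n by auto
    then have cn: "cont_nash r u1 u2 (Suc n) f g h" using L by (metis spe_def)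
    \<comment> \<open>The histories reached after \<open>h\<close> are longer than \<open>h\<close>,
      so a change at \<open>h\<close> alone leaves all continuation values as they were.\<close>
    have upd1: "rval u n (f(h := t)) g (h @ [x]) = rval u n f g (h @ [x])" for u t x
      by (rule rval_cong) auto
    have upd2: "rval u n f (g(h := t)) (h @ [x]) = rval u n f g (h @ [x])" for u t x
      by (rule rval_cong) auto
    have "eu (stage u1 n f g h) t (g h) \<le> eu (stage u1 n f g h) (f h) (g h)" if "t \<in> avail1 r" for t
    proof -
      have "strat1 r (f(h := t))" using st that by (auto simp: strat1_def)
      then have "rval u1 (Suc n) (f(h := t)) g h \<le> rval u1 (Suc n) f g h"
        using cn by (auto simp: cont_nash_def)
      then show ?thesis by (simp add: rval_Suc_eu upd1 del: rval.simps)
    qed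
    moreover have "eu (stage u2 n f g h) (f h) t \<le> eu (stage u2 n f g h) (f h) (g h)" if "t \<in> avail2 r" for t
    proof -
      have "strat2 r (g(h := t))" using st that by (auto simp: strat2_def)
      then have "rval u2 (Suc n) f (g(h := t)) h \<le> rval u2 (Suc n) f g h"
        using cn by (auto simp: cont_nash_def)
      then show ?thesis by (simp add: rval_Suc_eu upd2 del: rval.simps)
    qed
    ultimately show ?thesis
      using st by (simp add: nash_def strat1_def strat2_def)
  qed
  then show ?R using st by blast
next
  assume R: ?R
  have 1: "rval u1 n f' g h \<le> rval u1 n f g h" if "length h + n = T" "strat1 r f'" for n h f'
    using that
  proof (induction n arbitrary: h)
    case (Suc n)
    have "rval u1 n f' g (h @ [x]) \<le> rval u1 n f g (h @ [x])" for x
      using Suc.prems by (intro Suc.IH) auto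
    then have "eu (stage u1 n f' g h) (f' h) (g h) \<le> eu (stage u1 n f g h) (f' h) (g h)"
      by (intro eu_mono) simp
    also have "\<dots> \<le> eu (stage u1 n f g h) (f h) (g h)"
      using R Suc.prems by (auto simp: nash_def strat1_def)
    finally show ?case by (simp add: rval_Suc_eu del: rval.simps)
  qed simp
  have 2: "rval u2 n f g' h \<le> rval u2 n f g h" if "length h + n = T" "strat2 r g'" for n h g'
    using that
  proof (induction n arbitrary: h)
    case (Suc n)
    have "rval u2 n f g' (h @ [x]) \<le> rval u2 n f g (h @ [x])" for x
      using Suc.prems by (intro Suc.IH) auto
    then have "eu (stage u2 n f g' h) (f h) (g' h) \<le> eu (stage u2 n f g h) (f h) (g' h)"
      by (intro eu_mono) simp
    also have "\<dots> \<le> eu (stage u2 n f g h) (f h) (g h)"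
      using R Suc.prems by (auto simp: nash_def strat2_def)
    finally show ?case by (simp add: rval_Suc_eu del: rval.simps)
  qed simp
  show ?L using R 1 2 by (auto simp: spe_def cont_nash_def)
qed


subsection \<open>Rewarding first-round play by sequences of stage equilibria\<close>

text \<open>All lists share the length \<open>N\<close>, so they can fill the remaining rounds of a
  game whose length does not depend on the cell played.\<close>

definition nash_sums :: "regime \<Rightarrow> ('a::finite \<Rightarrow> 'b::finite \<Rightarrow> real) \<Rightarrow> ('a \<Rightarrow> 'b \<Rightarrow> real)
    \<Rightarrow> ('a \<Rightarrow> 'b \<Rightarrow> real) \<Rightarrow> ('a \<Rightarrow> 'b \<Rightarrow> real) \<Rightarrow> bool" where
  "nash_sums r u1 u2 w1 w2 \<longleftrightarrow> (\<exists>N L. \<forall>a b. length (L a b) = N \<and> set (L a b) \<subseteq> nash r u1 u2 \<and>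
     w1 a b = (\<Sum>p\<leftarrow>L a b. eu u1 (fst p) (snd p)) \<and>
     w2 a b = (\<Sum>p\<leftarrow>L a b. eu u2 (fst p) (snd p)))"

lemma nash_sums_zero: "nash_sums r u1 u2 (\<lambda>a b. 0) (\<lambda>a b. 0)"
  unfolding nash_sums_def by (intro exI[of _ 0] exI[of _ "\<lambda>a b. []"]) auto

lemma nash_sums_if:
  assumes "p \<in> nash r u1 u2" "q \<in> nash r u1 u2"
  shows "nash_sums r u1 u2 (\<lambda>a b. if C a b then eu u1 (fst p) (snd p) else eu u1 (fst q) (snd q))
    (\<lambda>a b. if C a b then eu u2 (fst p) (snd p) else eu u2 (fst q) (snd q))"
  unfolding nash_sums_def using assms
  by (intro exI[of _ 1] exI[of _ "\<lambda>a b. [if C a b then p else q]"]) auto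

lemma nash_sums_add:
  assumes "nash_sums r u1 u2 w1 w2" "nash_sums r u1 u2 w1' w2'"
  shows "nash_sums r u1 u2 (\<lambda>a b. w1 a b + w1' a b) (\<lambda>a b. w2 a b + w2' a b)"
proof -
  obtain N L where "\<And>a b. length (L a b) = N \<and> set (L a b) \<subseteq> nash r u1 u2 \<and>
     w1 a b = (\<Sum>p\<leftarrow>L a b. eu u1 (fst p) (snd p)) \<and>
     w2 a b = (\<Sum>p\<leftarrow>L a b. eu u2 (fst p) (snd p))"
    using assms(1) unfolding nash_sums_def by blast
  moreover obtain N' L' where "\<And>a b. length (L' a b) = N' \<and> set (L' a b) \<subseteq> nash r u1 u2 \<and>
     w1' a b = (\<Sum>p\<leftarrow>L' a b. eu u1 (fst p) (snd p)) \<and>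
     w2' a b = (\<Sum>p\<leftarrow>L' a b. eu u2 (fst p) (snd p))"
    using assms(2) unfolding nash_sums_def by blast
  ultimately show ?thesis
    unfolding nash_sums_def by (intro exI[of _ "N + N'"] exI[of _ "\<lambda>a b. L a b @ L' a b"]) auto
qed

lemma nash_sums_sum:
  assumes "finite I" "\<And>i. i \<in> I \<Longrightarrow> nash_sums r u1 u2 (w1 i) (w2 i)"
  shows "nash_sums r u1 u2 (\<lambda>a b. \<Sum>i\<in>I. w1 i a b) (\<lambda>a b. \<Sum>i\<in>I. w2 i a b)"
  using assms by (induction I) (auto intro: nash_sums_zero nash_sums_add)

lemma nash_sums_scale:
  assumes "nash_sums r u1 u2 w1 w2"
  shows "nash_sums r u1 u2 (\<lambda>a b. real M * w1 a b) (\<lambda>a b. real M * w2 a b)"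
  using nash_sums_sum[of "{..<M}" r u1 u2 "\<lambda>_. w1" "\<lambda>_. w2"] assms by simp

text \<open>Reduces the search for a suboptimal subgame perfect equilibrium to a question about a
  single rewarded stage game.\<close>

definition rewardable :: "regime \<Rightarrow> ('a::finite \<Rightarrow> 'b::finite \<Rightarrow> real) \<Rightarrow> ('a \<Rightarrow> 'b \<Rightarrow> real) \<Rightarrow> bool" where
  "rewardable r u1 u2 \<longleftrightarrow> (\<exists>w1 w2 s1 s2. nash_sums r u1 u2 w1 w2 \<and>
     (s1, s2) \<in> nash r (\<lambda>a b. u1 a b + w1 a b) (\<lambda>a b. u2 a b + w2 a b) \<and>
     (s1, s2) \<notin> nash r u1 u2)"

text \<open>The game has \<open>N + 1\<close> rounds: first \<open>(s1, s2)\<close>, then the list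
  selected by the actions realised in the first round.\<close>

lemma rewardable_imp_GLS:
  fixes u1 :: "'a::finite \<Rightarrow> 'b::finite \<Rightarrow> real" and u2 :: "'a \<Rightarrow> 'b \<Rightarrow> real"
  assumes "rewardable r u1 u2"
  shows "GLS r u1 u2"
proof -
  obtain w1 w2 s1 s2 where w: "nash_sums r u1 u2 w1 w2"
    and eq: "(s1, s2) \<in> nash r (\<lambda>a b. u1 a b + w1 a b) (\<lambda>a b. u2 a b + w2 a b)"
    and not_eq: "(s1, s2) \<notin> nash r u1 u2"
    using assms unfolding rewardable_def by blast
  obtain N L where "\<forall>a b. length (L a b) = N \<and> set (L a b) \<subseteq> nash r u1 u2 \<and>
     w1 a b = (\<Sum>p\<leftarrow>L a b. eu u1 (fst p) (snd p)) \<and>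
     w2 a b = (\<Sum>p\<leftarrow>L a b. eu u2 (fst p) (snd p))"
    using w unfolding nash_sums_def by blast
  then have L: "\<And>a b. length (L a b) = N" "\<And>a b. set (L a b) \<subseteq> nash r u1 u2"
     "\<And>a b. w1 a b = (\<Sum>p\<leftarrow>L a b. eu u1 (fst p) (snd p))"
     "\<And>a b. w2 a b = (\<Sum>p\<leftarrow>L a b. eu u2 (fst p) (snd p))"
    by simp_all
  define K where "K h = L (fst (hd h)) (snd (hd h))" for h
  \<comment> \<open>The index is \<open>length h - 1\<close> because the first round uses no list
    entry. Histories longer than \<open>N\<close> lie beyond the game and receive
    \<open>(s1, s2)\<close> as a default.\<close>
  define \<sigma> where "\<sigma> h = (if h \<noteq> [] \<and> length h \<le> N then K h ! (length h - 1) else (s1, s2))" for h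
  define f where "f h = fst (\<sigma> h)" for h
  define g where "g h = snd (\<sigma> h)" for h
  have K: "length (K h) = N" "set (K h) \<subseteq> nash r u1 u2" for h
    by (auto simp: K_def L dest: subsetD[OF L(2)])
  have s: "s1 \<in> avail1 r" "s2 \<in> avail2 r" using eq by (auto simp: nash_def)
  have \<sigma>_nash: "\<sigma> h \<in> nash r u1 u2" if "h \<noteq> []" "length h \<le> N" for h
  proof -
    have "length h - 1 < length (K h)" using that K by (cases h) auto
    then show ?thesis using that K(2)[of h] by (auto simp: \<sigma>_def intro: nth_mem)
  qed
  have "\<sigma> h \<in> avail1 r \<times> avail2 r" for h
  proof (cases "h \<noteq> [] \<and> length h \<le> N")
    case True
    then show ?thesis using \<sigma>_nash[of h] by (auto simp: nash_def)
  next
    case False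
    then show ?thesis using s by (auto simp: \<sigma>_def)
  qed
  then have st: "strat1 r f" "strat2 r g"
    by (auto simp: strat1_def strat2_def f_def g_def mem_Times_iff)
  \<comment> \<open>The list is fixed by the first round, so the value is the sum over its unplayed
    entries.\<close>
  have val: "rval u n f g h = (\<Sum>p\<leftarrow>drop (length h - 1) (K h). eu u (fst p) (snd p))"
    if "h \<noteq> []" "length h + n = Suc N" for u n h
    using that
  proof (induction n arbitrary: h)
    case 0
    then show ?case using K by simp
  next
    case (Suc n)
    have "rval u n f g (h @ [x]) = (\<Sum>p\<leftarrow>drop (length h) (K h). eu u (fst p) (snd p))" for x
      using Suc.IH[of "h @ [x]"] Suc.prems by (simp add: K_def hd_append)
    then have "rval u (Suc n) f g h =
        eu u (f h) (g h) + (\<Sum>p\<leftarrow>drop (length h) (K h). eu u (fst p) (snd p))"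
      by (simp add: rval_Suc_eu eu_add del: rval.simps)
    moreover have "drop (length h - 1) (K h) = \<sigma> h # drop (length h) (K h)"
      using Cons_nth_drop_Suc[of "length h - 1" "K h"] Suc.prems K by (cases h) (auto simp: \<sigma>_def)
    ultimately show ?case by (simp add: f_def[of h] g_def[of h] del: rval.simps)
  qed
  have "spe r u1 u2 (Suc N) f g"
    unfolding spe_iff_one_shot
  proof (intro conjI st allI impI)
    fix h :: "('a \<times> 'b) list" and n
    assume n: "length h + Suc n = Suc N"
    \<comment> \<open>In the first round the continuation values are exactly \<open>w1\<close> and
      \<open>w2\<close>; afterwards they do not vary with the current actions, and
      \<open>nash_add_const\<close> applies.\<close>
    show "(f h, g h) \<in> nash r (stage u1 n f g h) (stage u2 n f g h)"
    proof (cases "h = []")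
      case True
      then have "rval u n f g (h @ [(a, b)]) = (\<Sum>p\<leftarrow>L a b. eu u (fst p) (snd p))" for u a b
        using n val[of "[(a, b)]" n u] by (simp add: K_def)
      then show ?thesis
        using eq True by (simp add: f_def g_def \<sigma>_def L)
    next
      case False
      then have "rval u n f g (h @ [(a, b)]) = (\<Sum>p\<leftarrow>drop (length h) (K h). eu u (fst p) (snd p))" for u a b
        using n val[of "h @ [(a, b)]" n u] by (simp add: K_def hd_append)
      moreover have "(f h, g h) \<in> nash r u1 u2"
        using \<sigma>_nash[of h] False n by (simp add: f_def g_def)
      ultimately show ?thesis by (simp add: nash_add_const)
    qed
  qed
  moreover have "(f [], g []) \<notin> nash r u1 u2"
    using not_eq by (simp add: f_def g_def \<sigma>_def)
  ultimately show ?thesis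
    unfolding GLS_def by (intro exI[of _ "Suc N"] conjI exI[of _ f] exI[of _ g] exI[of _ "[]"]) auto
qed


section \<open>Sufficient conditions for rewardability\<close>

lemma uniform_multiple:
  fixes f :: "'a::finite \<Rightarrow> real"
  assumes "d > 0"
  shows "\<exists>M :: nat. \<forall>a. f a \<le> real M * d"
proof -
  obtain M :: nat where M: "(\<Sum>a\<in>UNIV. \<bar>f a\<bar>) < real M * d"
    using reals_Archimedean3[OF assms] by blast
  have "f a \<le> real M * d" for a
  proof -
    have "f a \<le> \<bar>f a\<bar>" by simp
    also have "\<dots> \<le> (\<Sum>a\<in>UNIV. \<bar>f a\<bar>)" by (rule member_le_sum) auto
    finally show ?thesis using M by simp
  qed
  then show ?thesis by blast
qed

lemma card_1_iff_not_several: "card V = 1 \<longleftrightarrow> V \<noteq> {} \<and> \<not> several V"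
proof
  assume "card V = 1"
  then obtain v where "V = {v}" by (auto simp: card_1_singleton_iff)
  then show "V \<noteq> {} \<and> \<not> several V" by (auto simp: several_def)
next
  assume V: "V \<noteq> {} \<and> \<not> several V"
  then obtain v where "v \<in> V" by blast
  then have "V = {v}" using V by (auto simp: several_def)
  then show "card V = 1" by simp
qed

lemma V_image:
  "V1 r u1 u2 = (\<lambda>p. eu u1 (fst p) (snd p)) ` nash r u1 u2"
  "V2 r u1 u2 = (\<lambda>p. eu u2 (fst p) (snd p)) ` nash r u1 u2"
  by (simp_all add: V1_def V2_def case_prod_beta)

lemma several_V1_E:
  assumes "several (V1 r u1 u2)"
  obtains p q where "p \<in> nash r u1 u2" "q \<in> nash r u1 u2"
    "eu u1 (fst q) (snd q) < eu u1 (fst p) (snd p)"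
proof -
  obtain p q where pq: "p \<in> nash r u1 u2" "q \<in> nash r u1 u2"
    "eu u1 (fst p) (snd p) \<noteq> eu u1 (fst q) (snd q)"
    using assms unfolding several_def V_image by blast
  then show ?thesis using that[of p q] that[of q p] by linarith
qed

lemma several_V2_E:
  assumes "several (V2 r u1 u2)"
  obtains p q where "p \<in> nash r u1 u2" "q \<in> nash r u1 u2"
    "eu u2 (fst q) (snd q) < eu u2 (fst p) (snd p)"
proof -
  obtain p q where pq: "p \<in> nash r u1 u2" "q \<in> nash r u1 u2"
    "eu u2 (fst p) (snd p) \<noteq> eu u2 (fst q) (snd q)"
    using assms unfolding several_def V_image by blast
  then show ?thesis using that[of p q] that[of q p] by linarith
qed

lemma single_V1_E:
  assumes "card (V1 r u1 u2) = 1"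
  obtains v where "\<forall>p\<in>nash r u1 u2. eu u1 (fst p) (snd p) = v"
proof -
  obtain v where "V1 r u1 u2 = {v}" using assms by (auto simp: card_1_singleton_iff)
  then show ?thesis using that[of v] unfolding V_image by blast
qed

lemma single_V2_E:
  assumes "card (V2 r u1 u2) = 1"
  obtains v where "\<forall>p\<in>nash r u1 u2. eu u2 (fst p) (snd p) = v"
proof -
  obtain v where "V2 r u1 u2 = {v}" using assms by (auto simp: card_1_singleton_iff)
  then show ?thesis using that[of v] unfolding V_image by blast
qed

lemma sum_list_map_const:
  assumes "\<And>p. p \<in> set ps \<Longrightarrow> f p = (c :: real)"
  shows "(\<Sum>p\<leftarrow>ps. f p) = real (length ps) * c"
  using assms by (induction ps) (auto simp: algebra_simps)

text \<open>Equally many copies of one value have the same sum in every cell, so the incentives of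
  that player cannot be altered.\<close>

lemma nash_sums_single:
  assumes "nash_sums r u1 u2 w1 w2"
  shows "card (V1 r u1 u2) = 1 \<Longrightarrow> \<exists>c. w1 = (\<lambda>a b. c)"
    and "card (V2 r u1 u2) = 1 \<Longrightarrow> \<exists>c. w2 = (\<lambda>a b. c)"
proof -
  obtain N L where L: "\<forall>a b. length (L a b) = N \<and> set (L a b) \<subseteq> nash r u1 u2 \<and>
     w1 a b = (\<Sum>p\<leftarrow>L a b. eu u1 (fst p) (snd p)) \<and>
     w2 a b = (\<Sum>p\<leftarrow>L a b. eu u2 (fst p) (snd p))"
    using assms unfolding nash_sums_def by blast
  show "\<exists>c. w1 = (\<lambda>a b. c)" if single: "card (V1 r u1 u2) = 1"
  proof -
    obtain v where v: "\<forall>p\<in>nash r u1 u2. eu u1 (fst p) (snd p) = v"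
      by (rule single_V1_E[OF single])
    have "w1 a b = real N * v" for a b
      using L sum_list_map_const[of "L a b" "\<lambda>p. eu u1 (fst p) (snd p)" v] v
      by (metis subsetD)
    then show ?thesis by blast
  qed
  show "\<exists>c. w2 = (\<lambda>a b. c)" if single: "card (V2 r u1 u2) = 1"
  proof -
    obtain v where v: "\<forall>p\<in>nash r u1 u2. eu u2 (fst p) (snd p) = v"
      by (rule single_V2_E[OF single])
    have "w2 a b = real N * v" for a b
      using L sum_list_map_const[of "L a b" "\<lambda>p. eu u2 (fst p) (snd p)" v] v
      by (metis subsetD)
    then show ?thesis by blast
  qed
qed

text \<open>Each player is disciplined by rounds that depend on that player's own action only. Such
  rounds change the payoffs of both players but not the incentives of the other one.\<close>

lemma rewardable_both:
  assumes sev: "several (V1 r u1 u2)" "several (V2 r u1 u2)"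
    and not_eq: "(return_pmf a, return_pmf b) \<notin> nash r u1 u2"
  shows "rewardable r u1 u2"
proof -
  obtain p q where pq: "p \<in> nash r u1 u2" "q \<in> nash r u1 u2"
    "eu u1 (fst q) (snd q) < eu u1 (fst p) (snd p)"
    by (rule several_V1_E[OF sev(1)])
  obtain p' q' where pq': "p' \<in> nash r u1 u2" "q' \<in> nash r u1 u2"
    "eu u2 (fst q') (snd q') < eu u2 (fst p') (snd p')"
    by (rule several_V2_E[OF sev(2)])
  \<comment> \<open>\<open>M\<close> repetitions of the gap between \<open>p\<close> and
    \<open>q\<close> cover every one-round gain of player 1; \<open>M'\<close> does the same for
    player 2.\<close>
  obtain M :: nat where M: "\<forall>a'. u1 a' b - u1 a b \<le> real M * (eu u1 (fst p) (snd p) - eu u1 (fst q) (snd q))"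
    using uniform_multiple[of "eu u1 (fst p) (snd p) - eu u1 (fst q) (snd q)" "\<lambda>a'. u1 a' b - u1 a b"] pq(3)
    unfolding diff_gt_0_iff_gt by blast
  obtain M' :: nat where M': "\<forall>b'. u2 a b' - u2 a b \<le> real M' * (eu u2 (fst p') (snd p') - eu u2 (fst q') (snd q'))"
    using uniform_multiple[of "eu u2 (fst p') (snd p') - eu u2 (fst q') (snd q')" "\<lambda>b'. u2 a b' - u2 a b"] pq'(3)
    unfolding diff_gt_0_iff_gt by blast
  show ?thesis
    unfolding rewardable_def
  proof (intro exI conjI)
    show "nash_sums r u1 u2
      (\<lambda>a' b'. real M * (if a' = a then eu u1 (fst p) (snd p) else eu u1 (fst q) (snd q)) +
         real M' * (if b' = b then eu u1 (fst p') (snd p') else eu u1 (fst q') (snd q')))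
      (\<lambda>a' b'. real M * (if a' = a then eu u2 (fst p) (snd p) else eu u2 (fst q) (snd q)) +
         real M' * (if b' = b then eu u2 (fst p') (snd p') else eu u2 (fst q') (snd q')))"
      by (intro nash_sums_add nash_sums_scale nash_sums_if pq pq')
    show "(return_pmf a, return_pmf b) \<notin> nash r u1 u2" by (rule not_eq)
  qed (use M M' in \<open>auto simp: nash_iff_pure algebra_simps\<close>)
qed

text \<open>The rewards \<open>w1\<close> equalise the support of \<open>s1\<close>; a further
  reward, uniform on the support, deters all other actions. The rewards of player 2 are constant by
  \<open>nash_sums_single\<close>.\<close>

lemma rewardable_player1:
  assumes sev: "several (V1 r u1 u2)" and single: "card (V2 r u1 u2) = 1"
    and avail: "s1 \<in> avail1 r" "s2 \<in> avail2 r"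
    and best: "\<And>b. eu u2 s1 (return_pmf b) \<le> eu u2 s1 s2"
    and dev: "eu u1 s1 s2 < eu u1 (return_pmf a') s2"
    and w: "nash_sums r u1 u2 w1 w2"
    and indiff: "\<And>a. a \<in> set_pmf s1 \<Longrightarrow> eu (\<lambda>a b. u1 a b + w1 a b) (return_pmf a) s2 = c"
  shows "rewardable r u1 u2"
proof -
  obtain p q where pq: "p \<in> nash r u1 u2" "q \<in> nash r u1 u2"
    "eu u1 (fst q) (snd q) < eu u1 (fst p) (snd p)"
    by (rule several_V1_E[OF sev])
  define P where "P = eu u1 (fst p) (snd p)"
  define Q where "Q = eu u1 (fst q) (snd q)"
  have "P - Q > 0" using pq(3) by (simp add: P_def Q_def)
  then obtain M :: nat where M: "\<forall>a. eu (\<lambda>a b. u1 a b + w1 a b) (return_pmf a) s2 - c \<le> real M * (P - Q)"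
    using uniform_multiple[of "P - Q" "\<lambda>a. eu (\<lambda>a b. u1 a b + w1 a b) (return_pmf a) s2 - c"] by blast
  define z1 where "z1 = (\<lambda>a (b :: 'b). real M * (if a \<in> set_pmf s1 then P else Q))"
  define z2 where "z2 = (\<lambda>a (b :: 'b). real M *
    (if a \<in> set_pmf s1 then eu u2 (fst p) (snd p) else eu u2 (fst q) (snd q)))"
  have sums: "nash_sums r u1 u2 (\<lambda>a b. w1 a b + z1 a b) (\<lambda>a b. w2 a b + z2 a b)"
    unfolding z1_def z2_def P_def Q_def by (intro nash_sums_add nash_sums_scale nash_sums_if pq w)
  obtain k where k: "(\<lambda>a b. w2 a b + z2 a b) = (\<lambda>a b. k)"
    using nash_sums_single(2)[OF sums single] by blast
  have z1: "eu z1 (return_pmf a) s2 = real M * (if a \<in> set_pmf s1 then P else Q)" for a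
    by (simp add: z1_def eu_return1 pmf_avg_const)
  have val: "eu (\<lambda>a b. u1 a b + (w1 a b + z1 a b)) (return_pmf a) s2 =
      eu (\<lambda>a b. u1 a b + w1 a b) (return_pmf a) s2 + real M * (if a \<in> set_pmf s1 then P else Q)" for a
    by (simp only: add.assoc[symmetric] eu_add z1)
  have "eu (\<lambda>a b. u1 a b + (w1 a b + z1 a b)) s1 s2 = c + real M * P"
    by (subst eu_pure1, rule antisym; rule pmf_avg_le pmf_avg_ge) (simp_all add: val indiff)
  moreover have "eu (\<lambda>a b. u1 a b + (w1 a b + z1 a b)) (return_pmf a) s2 \<le> c + real M * P" for a
    using M[rule_format, of a] by (simp add: val indiff algebra_simps)
  ultimately have "(s1, s2) \<in> nash r (\<lambda>a b. u1 a b + (w1 a b + z1 a b)) (\<lambda>a b. u2 a b + (w2 a b + z2 a b))"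
    using avail best by (simp add: nash_iff_pure fun_cong[OF fun_cong[OF k]] eu_add[of u2])
  moreover have "(s1, s2) \<notin> nash r u1 u2"
    using dev by (auto simp: nash_iff_pure not_le)
  ultimately show ?thesis
    using sums unfolding rewardable_def by blast
qed

text \<open>The prescribed \<open>b\<close> is pure, so each deviation from it is observed and can
  be punished, while constant rewards for player 1 preserve the best response
  \<open>s1\<close>.\<close>

lemma rewardable_player2:
  assumes sev: "several (V2 r u1 u2)" and single: "card (V1 r u1 u2) = 1"
    and avail: "s1 \<in> avail1 r"
    and best: "\<And>a. eu u1 (return_pmf a) (return_pmf b) \<le> eu u1 s1 (return_pmf b)"
    and dev: "eu u2 s1 (return_pmf b) < eu u2 s1 (return_pmf b')"
  shows "rewardable r u1 u2"
proof -
  obtain p q where pq: "p \<in> nash r u1 u2" "q \<in> nash r u1 u2"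
    "eu u2 (fst q) (snd q) < eu u2 (fst p) (snd p)"
    by (rule several_V2_E[OF sev])
  define P where "P = eu u2 (fst p) (snd p)"
  define Q where "Q = eu u2 (fst q) (snd q)"
  have "P - Q > 0" using pq(3) by (simp add: P_def Q_def)
  then obtain M :: nat where M: "\<forall>y. eu u2 s1 (return_pmf y) - eu u2 s1 (return_pmf b) \<le> real M * (P - Q)"
    using uniform_multiple[of "P - Q" "\<lambda>y. eu u2 s1 (return_pmf y) - eu u2 s1 (return_pmf b)"] by blast
  define w1 where "w1 = (\<lambda>(a :: 'a) y. real M *
    (if y = b then eu u1 (fst p) (snd p) else eu u1 (fst q) (snd q)))"
  define w2 where "w2 = (\<lambda>(a :: 'a) y. real M * (if y = b then P else Q))"
  have sums: "nash_sums r u1 u2 w1 w2"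
    unfolding w1_def w2_def P_def Q_def by (intro nash_sums_scale nash_sums_if pq)
  obtain k where k: "w1 = (\<lambda>a b. k)"
    using nash_sums_single(1)[OF sums single] by blast
  have w2: "eu w2 s1 (return_pmf y) = real M * (if y = b then P else Q)" for y
    by (simp add: w2_def eu_return2 pmf_avg_const)
  have "eu u2 s1 (return_pmf y) + eu w2 s1 (return_pmf y) \<le> eu u2 s1 (return_pmf b) + eu w2 s1 (return_pmf b)" for y
    using M[rule_format, of y] by (simp add: w2 algebra_simps)
  then have "(s1, return_pmf b) \<in> nash r (\<lambda>a b. u1 a b + w1 a b) (\<lambda>a b. u2 a b + w2 a b)"
    using avail best by (simp add: nash_iff_pure k eu_add del: eu_return)
  moreover have "(s1, return_pmf b) \<notin> nash r u1 u2"
    using dev by (auto simp: nash_iff_pure not_le)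
  ultimately show ?thesis
    using sums unfolding rewardable_def by blast
qed

lemma rewardable_MM_swap:
  fixes u1 :: "'a::finite \<Rightarrow> 'b::finite \<Rightarrow> real" and u2 :: "'a \<Rightarrow> 'b \<Rightarrow> real"
  assumes "rewardable MM (\<lambda>b a. u2 a b) (\<lambda>b a. u1 a b)"
  shows "rewardable MM u1 u2"
proof -
  let ?v1 = "\<lambda>b a. u2 a b" and ?v2 = "\<lambda>b a. u1 a b"
  obtain w1 w2 t s N L where
    eq: "(t, s) \<in> nash MM (\<lambda>b a. u2 a b + w1 b a) (\<lambda>b a. u1 a b + w2 b a)"
    and not_eq: "(t, s) \<notin> nash MM ?v1 ?v2"
    and L: "\<forall>b a. length (L b a) = N \<and> set (L b a) \<subseteq> nash MM ?v1 ?v2 \<and>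
     w1 b a = (\<Sum>p\<leftarrow>L b a. eu ?v1 (fst p) (snd p)) \<and>
     w2 b a = (\<Sum>p\<leftarrow>L b a. eu ?v2 (fst p) (snd p))"
    using assms unfolding rewardable_def nash_sums_def by blast
  have "nash_sums MM u1 u2 (\<lambda>a b. w2 b a) (\<lambda>a b. w1 b a)"
    unfolding nash_sums_def
  proof (intro exI allI conjI)
    fix a b
    show "length (map prod.swap (L b a)) = N" using L by simp
    show "set (map prod.swap (L b a)) \<subseteq> nash MM u1 u2"
      using L by (fastforce simp: nash_MM_swap[of _ _ u2 u1, symmetric])
    show "w2 b a = (\<Sum>p\<leftarrow>map prod.swap (L b a). eu u1 (fst p) (snd p))"
      using L by (simp add: comp_def eu_swap[of u1])
    show "w1 b a = (\<Sum>p\<leftarrow>map prod.swap (L b a). eu u2 (fst p) (snd p))"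
      using L by (simp add: comp_def eu_swap[of u2])
  qed
  moreover have "(s, t) \<in> nash MM (\<lambda>a b. u1 a b + w2 b a) (\<lambda>a b. u2 a b + w1 b a)"
    using eq by (subst nash_MM_swap[symmetric])
  moreover have "(s, t) \<notin> nash MM u1 u2"
    using not_eq by (subst nash_MM_swap[symmetric])
  ultimately show ?thesis unfolding rewardable_def by blast
qed

lemma V_MM_swap:
  "V1 MM (\<lambda>b a. u2 a b) (\<lambda>b a. u1 a b) = V2 MM u1 u2"
  "V2 MM (\<lambda>b a. u2 a b) (\<lambda>b a. u1 a b) = V1 MM u1 u2"
proof -
  have "nash MM (\<lambda>b a. u2 a b) (\<lambda>b a. u1 a b) = prod.swap ` nash MM u1 u2"
    using nash_MM_swap[of _ _ u2 u1] by (auto simp: image_iff) force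
  then show "V1 MM (\<lambda>b a. u2 a b) (\<lambda>b a. u1 a b) = V2 MM u1 u2"
    "V2 MM (\<lambda>b a. u2 a b) (\<lambda>b a. u1 a b) = V1 MM u1 u2"
    by (simp_all add: V_image image_image eu_swap[of u1] eu_swap[of u2])
qed

text \<open>No exact indifference over the support of \<open>s1\<close> is assumed. So unless a pure
  action serves, the profile is not prescribed but obtained as an equilibrium of the rewarded
  game.\<close>

lemma rewardable_MM_player1:
  assumes sev: "several (V1 MM u1 u2)" and single: "card (V2 MM u1 u2) = 1"
    and best: "\<And>t. eu u2 s1 t \<le> eu u2 s1 s2"
    and dev: "eu u1 s1 s2 < eu u1 (return_pmf a') s2"
  shows "rewardable MM u1 u2"
proof (cases "\<exists>a t a'. (\<forall>b. eu u2 (return_pmf a) (return_pmf b) \<le> eu u2 (return_pmf a) t) \<and>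
    eu u1 (return_pmf a) t < eu u1 (return_pmf a') t")
  case True
  then obtain a t a' where "\<And>b. eu u2 (return_pmf a) (return_pmf b) \<le> eu u2 (return_pmf a) t"
    "eu u1 (return_pmf a) t < eu u1 (return_pmf a') t" by blast
  then show ?thesis
    by (intro rewardable_player1[where ?s1.0 = "return_pmf a" and ?s2.0 = t and a' = a' and
          c = "eu u1 (return_pmf a) t", OF sev single _ _ _ _ nash_sums_zero])
      (auto simp: avail1_def avail2_def)
next
  case False
  obtain v where v: "\<forall>p\<in>nash MM u1 u2. eu u2 (fst p) (snd p) = v"
    by (rule single_V2_E[OF single])
  \<comment> \<open>In this case \<open>a\<close> is optimal against every best response to
    it.\<close>
  have pure_nash: "(return_pmf a, t) \<in> nash MM u1 u2"
    if "\<And>b. u2 a b \<le> eu u2 (return_pmf a) t" for a t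
    using False that by (auto simp: nash_iff_pure avail2_def not_less)
  \<comment> \<open>The maximum of each row is attained in an equilibrium and hence equals
    \<open>v\<close>.\<close>
  have u2_le: "u2 a b \<le> v" for a b
  proof -
    have "Max (range (u2 a)) \<in> range (u2 a)" by (intro Max_in) auto
    then obtain m where "Max (range (u2 a)) = u2 a m" by blast
    then have m: "u2 a b \<le> u2 a m" for b
      using Max_ge[of "range (u2 a)" "u2 a b"] by simp
    then have "(return_pmf a, return_pmf m) \<in> nash MM u1 u2" by (intro pure_nash) simp
    then have "u2 a m = v" using v by fastforce
    then show ?thesis using m[of b] by simp
  qed
  \<comment> \<open>A column constantly \<open>v\<close> would guarantee player 2 \<open>v\<close>
    against \<open>s1\<close>. Then \<open>u2\<close> is \<open>v\<close> on the supports of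
    \<open>s1\<close> and \<open>s2\<close>, and every support action of \<open>s1\<close> forms an
    equilibrium with \<open>s2\<close>, contrary to \<open>dev\<close>.\<close>
  have no_column: "\<exists>a. u2 a b \<noteq> v" for b
  proof (rule ccontr)
    assume "\<not> ?thesis"
    then have "eu u2 s1 (return_pmf b) = v" by (simp add: eu_return2 pmf_avg_const)
    then have ge: "v \<le> eu u2 s1 s2" using best by metis
    have "eu u1 (return_pmf a') s2 \<le> eu u1 (return_pmf a) s2" if a: "a \<in> set_pmf s1" for a
    proof -
      have "u2 a b = v" if "b \<in> set_pmf s2" for b
        using eu_tight[OF u2_le ge a that] .
      then have "v \<le> eu u2 (return_pmf a) s2"
        unfolding eu_return1 by (intro pmf_avg_ge) simp
      then have "(return_pmf a, s2) \<in> nash MM u1 u2"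
        using u2_le order_trans by (intro pure_nash) blast
      then show ?thesis by (simp add: nash_iff_pure)
    qed
    then have "eu u1 (return_pmf a') s2 \<le> eu u1 s1 s2"
      by (subst eu_pure1[of u1 s1]) (rule pmf_avg_ge)
    then show False using dev by simp
  qed
  obtain p q where pq: "p \<in> nash MM u1 u2" "q \<in> nash MM u1 u2"
    "eu u1 (fst q) (snd q) < eu u1 (fst p) (snd p)"
    by (rule several_V1_E[OF sev])
  define P where "P = eu u1 (fst p) (snd p)"
  define Q where "Q = eu u1 (fst q) (snd q)"
  have PQ: "P - Q > 0" using pq(3) by (simp add: P_def Q_def)
  define B where "B = (\<Sum>a\<in>UNIV. \<Sum>b\<in>UNIV. \<bar>u1 a b\<bar>)"
  have B: "\<bar>u1 a b\<bar> \<le> B" for a b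
  proof -
    have "\<bar>u1 a b\<bar> \<le> (\<Sum>b\<in>UNIV. \<bar>u1 a b\<bar>)" by (rule member_le_sum) auto
    also have "\<dots> \<le> B" unfolding B_def
      by (rule member_le_sum[of _ _ "\<lambda>a. \<Sum>b\<in>UNIV. \<bar>u1 a b\<bar>"]) (auto intro: sum_nonneg)
    finally show ?thesis .
  qed
  \<comment> \<open>Exactly what the final comparison needs:
    \<open>CARD('a) * (M * Q - B) + M * (P - Q)\<close> exceeds
    \<open>CARD('a) * (B + M * Q)\<close>.\<close>
  obtain M :: nat where M: "2 * real CARD('a) * B < real M * (P - Q)"
    using reals_Archimedean3[OF PQ] by blast
  define w1 where "w1 = (\<lambda>a b. real M * (if u2 a b \<noteq> v then P else Q))"
  define w2 where "w2 = (\<lambda>a b. real M *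
    (if u2 a b \<noteq> v then eu u2 (fst p) (snd p) else eu u2 (fst q) (snd q)))"
  have sums: "nash_sums MM u1 u2 w1 w2"
    unfolding w1_def w2_def P_def Q_def by (intro nash_sums_scale nash_sums_if pq)
  obtain t1 t2 where t: "(t1, t2) \<in> nash MM (\<lambda>a b. u1 a b + w1 a b) (\<lambda>a b. u2 a b + w2 a b)"
    using nash_MM_nonempty by fastforce
  \<comment> \<open>A stage equilibrium would put all weight on cells with \<open>u2 = v\<close>,
    which earn the low reward. This caps every row against \<open>t2\<close> at
    \<open>B + M * Q\<close>, although each column contains a highly rewarded cell.\<close>
  have "(t1, t2) \<notin> nash MM u1 u2"
  proof
    assume "(t1, t2) \<in> nash MM u1 u2"
    then have ge: "v \<le> eu u2 t1 t2" using v by fastforce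
    have "u2 a b = v" if "a \<in> set_pmf t1" "b \<in> set_pmf t2" for a b
      using eu_tight[OF u2_le ge that] .
    then have "eu w1 t1 t2 = eu (\<lambda>a b. real M * Q) t1 t2"
      by (intro eu_cong_supp) (simp add: w1_def)
    moreover have "eu u1 t1 t2 \<le> eu (\<lambda>a b. B) t1 t2"
      by (intro eu_mono) (use B abs_le_D1 in blast)
    ultimately have le: "eu (\<lambda>a b. u1 a b + w1 a b) t1 t2 \<le> B + real M * Q"
      by (simp add: eu_add)
    have col: "real CARD('a) * (real M * Q - B) + real M * (P - Q) \<le> (\<Sum>a\<in>UNIV. u1 a b + w1 a b)" for b
    proof -
      obtain a0 where a0: "u2 a0 b \<noteq> v" using no_column by blast
      have "(\<Sum>a\<in>UNIV. (real M * Q - B) + (if a = a0 then real M * (P - Q) else 0)) \<le>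
          (\<Sum>a\<in>UNIV. u1 a b + w1 a b)"
      proof (rule sum_mono)
        fix a
        have "- B \<le> u1 a b" using B[of a b] by linarith
        moreover have "real M * Q + (if a = a0 then real M * (P - Q) else 0) \<le> w1 a b"
          using a0 PQ by (auto simp: w1_def algebra_simps intro: mult_right_mono)
        ultimately show "(real M * Q - B) + (if a = a0 then real M * (P - Q) else 0) \<le> u1 a b + w1 a b"
          by linarith
      qed
      then show ?thesis by (simp add: sum.distrib)
    qed
    \<comment> \<open>Averaging the column bound over \<open>t2\<close> and exchanging the sums
      bounds the total of all row payoffs from below.\<close>
    have "real CARD('a) * (real M * Q - B) + real M * (P - Q) \<le>
        (\<Sum>b\<in>UNIV. pmf t2 b * (\<Sum>a\<in>UNIV. u1 a b + w1 a b))"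
      by (intro pmf_avg_ge col)
    also have "\<dots> = (\<Sum>a\<in>UNIV. eu (\<lambda>a b. u1 a b + w1 a b) (return_pmf a) t2)"
      unfolding eu_return1 sum_distrib_left by (rule sum.swap)
    also have "\<dots> \<le> (\<Sum>a\<in>(UNIV :: 'a set). B + real M * Q)"
      by (intro sum_mono order_trans[OF _ le]) (use t in \<open>auto simp: nash_iff_pure\<close>)
    finally show False using M by (simp add: algebra_simps)
  qed
  then show ?thesis using sums t unfolding rewardable_def by blast
qed

text \<open>If all pure profiles are equilibria, no player's payoff ever depends on the player's own
  action, so every available profile is an equilibrium.\<close>

lemma ex_non_nash_pure:
  assumes not_eq: "(s1, s2) \<notin> nash r u1 u2" and avail: "s1 \<in> avail1 r" "s2 \<in> avail2 r"
  shows "\<exists>a b. (return_pmf a, return_pmf b) \<notin> nash r u1 u2"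
proof (rule ccontr)
  assume "\<not> ?thesis"
  then have le: "u1 a' b \<le> u1 a b" "u2 a b' \<le> u2 a b" for a a' b b'
    by (auto simp: nash_iff_pure)
  have "eu u1 (return_pmf a) s2 \<le> eu u1 s1 s2" for a
    by (subst eu_pure1[of u1 s1], rule pmf_avg_ge) (auto simp: eu_return1 intro!: sum_mono mult_left_mono le)
  moreover have "eu u2 s1 (return_pmf b) \<le> eu u2 s1 s2" for b
    by (subst eu_pure2[of u2 s1 s2], rule pmf_avg_ge) (auto simp: eu_return2 intro!: sum_mono mult_left_mono le)
  ultimately show False using not_eq avail by (auto simp: nash_iff_pure)
qed

section \<open>Sufficiency of \<open>Cmm\<close> and \<open>Cmp\<close>\<close>

lemma Cmm_imp_GLS:
  assumes "Cmm u1 u2"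
  shows "GLS MM u1 u2"
proof (rule rewardable_imp_GLS)
  consider
    (both) s1 s2 where "several (V1 MM u1 u2)" "several (V2 MM u1 u2)" "(s1, s2) \<notin> nash MM u1 u2"
  | (one) s1 s2 a' where "several (V1 MM u1 u2)" "card (V2 MM u1 u2) = 1"
      "eu u1 s1 s2 < eu u1 (return_pmf a') s2" "\<forall>t. eu u2 s1 t \<le> eu u2 s1 s2"
  | (two) s1 s2 b' where "card (V1 MM u1 u2) = 1" "several (V2 MM u1 u2)"
      "eu u2 s1 s2 < eu u2 s1 (return_pmf b')" "\<forall>t. eu u1 t s2 \<le> eu u1 s1 s2"
    using assms unfolding Cmm_def by blast
  then show "rewardable MM u1 u2"
  proof cases
    case both
    then obtain a b where "(return_pmf a, return_pmf b) \<notin> nash MM u1 u2"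
      using ex_non_nash_pure[of s1 s2 MM u1 u2] by (auto simp: avail1_def avail2_def)
    then show ?thesis using both by (intro rewardable_both)
  next
    case one
    show ?thesis by (rule rewardable_MM_player1[OF one(1,2) _ one(3)]) (use one(4) in blast)
  next
    case two
    have "rewardable MM (\<lambda>b a. u2 a b) (\<lambda>b a. u1 a b)"
    proof (rule rewardable_MM_player1)
      show "several (V1 MM (\<lambda>b a. u2 a b) (\<lambda>b a. u1 a b))"
        "card (V2 MM (\<lambda>b a. u2 a b) (\<lambda>b a. u1 a b)) = 1"
        unfolding V_MM_swap[of u2 u1] by (rule two)+
      show "eu (\<lambda>b a. u1 a b) s2 t \<le> eu (\<lambda>b a. u1 a b) s2 s1" for t
        unfolding eu_swap[of u1] using two(4) by simp
      show "eu (\<lambda>b a. u2 a b) s2 s1 < eu (\<lambda>b a. u2 a b) (return_pmf b') s1"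
        unfolding eu_swap[of u2] by (rule two(3))
    qed
    then show ?thesis by (rule rewardable_MM_swap)
  qed
qed

text \<open>Playing \<open>p\<close> on \<open>C\<close> and \<open>q\<close> elsewhere adds one
  difference on \<open>C\<close> and shifts all cells by the payoff at \<open>q\<close>; the shifts
  collect in \<open>K\<close>.\<close>

lemma nash_sums_diff:
  assumes "set ds \<subseteq> {eu u1 (fst p) (snd p) - eu u1 (fst q) (snd q) | p q.
    p \<in> nash r u1 u2 \<and> q \<in> nash r u1 u2}"
  shows "\<exists>K w2. nash_sums r u1 u2 (\<lambda>a b. (if C a b then sum_list ds else 0) + K) w2"
  using assms
proof (induction ds)
  case Nil
  show ?case using nash_sums_zero[of r u1 u2]
    by (intro exI[of _ 0] exI[of _ "\<lambda>a b. 0"]) (simp cong: if_cong)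
next
  case (Cons d ds)
  then obtain K w2 where K: "nash_sums r u1 u2 (\<lambda>a b. (if C a b then sum_list ds else 0) + K) w2"
    by auto
  obtain p q where pq: "p \<in> nash r u1 u2" "q \<in> nash r u1 u2"
    "d = eu u1 (fst p) (snd p) - eu u1 (fst q) (snd q)"
    using Cons.prems by auto
  have "(\<lambda>a b. ((if C a b then sum_list ds else 0) + K) +
      (if C a b then eu u1 (fst p) (snd p) else eu u1 (fst q) (snd q))) =
    (\<lambda>a b. (if C a b then sum_list (d # ds) else 0) + (K + eu u1 (fst q) (snd q)))"
    by (auto simp: pq fun_eq_iff)
  then show ?case using nash_sums_add[OF K nash_sums_if[OF pq(1,2), of C]] by metis
qed

lemma Cmp_imp_GLS:
  assumes "Cmp u1 u2"
  shows "GLS MP u1 u2"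
proof (rule rewardable_imp_GLS)
  let ?D = "{eu u1 (fst p) (snd p) - eu u1 (fst q) (snd q) | p q. p \<in> nash MP u1 u2 \<and> q \<in> nash MP u1 u2}"
  consider
    (both) s1 b where "several (V1 MP u1 u2)" "several (V2 MP u1 u2)" "(s1, return_pmf b) \<notin> nash MP u1 u2"
  | (one) s1 b a' where "several (V1 MP u1 u2)" "card (V2 MP u1 u2) = 1"
      "eu u1 s1 (return_pmf b) < eu u1 (return_pmf a') (return_pmf b)"
      "\<forall>y. eu u2 s1 (return_pmf y) \<le> eu u2 s1 (return_pmf b)"
      "card (set_pmf s1) > 1 \<longrightarrow> (\<exists>a\<in>set_pmf s1. \<forall>a'\<in>set_pmf s1 - {a}.
                \<exists>ds. set ds \<subseteq> ?D \<and> u1 a b - u1 a' b = sum_list ds)"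
  | (two) s1 b b' where "card (V1 MP u1 u2) = 1" "several (V2 MP u1 u2)"
      "eu u2 s1 (return_pmf b) < eu u2 s1 (return_pmf b')"
      "\<forall>t. eu u1 t (return_pmf b) \<le> eu u1 s1 (return_pmf b)"
    using assms unfolding Cmp_def by blast
  then show "rewardable MP u1 u2"
  proof cases
    case both
    then obtain x y where "(return_pmf x, return_pmf y) \<notin> nash MP u1 u2"
      using ex_non_nash_pure[of s1 "return_pmf b" MP u1 u2] by (auto simp: avail1_def)
    then show ?thesis using both by (intro rewardable_both)
  next
    case one
    obtain a where a: "a \<in> set_pmf s1"
      "\<And>a'. a' \<in> set_pmf s1 - {a} \<Longrightarrow> \<exists>ds. set ds \<subseteq> ?D \<and> u1 a b - u1 a' b = sum_list ds"
    proof (cases "card (set_pmf s1) > 1")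
      case True
      then show ?thesis using one(5) that by blast
    next
      case False
      moreover have "card (set_pmf s1) \<noteq> 0" by (simp add: set_pmf_not_empty)
      ultimately have "card (set_pmf s1) = 1" by linarith
      then obtain a where "set_pmf s1 = {a}" by (auto simp: card_1_singleton_iff)
      then show ?thesis using that by auto
    qed
    \<comment> \<open>Up to a constant, this reward changes row \<open>a'\<close> alone, by what
      separates it from row \<open>a\<close> in column \<open>b\<close>.\<close>
    have "\<exists>K w2. nash_sums MP u1 u2 (\<lambda>x y. (if x = a' then u1 a b - u1 a' b else 0) + K) w2"
      if "a' \<in> set_pmf s1" for a'
    proof -
      obtain ds where ds: "set ds \<subseteq> ?D" "u1 a b - u1 a' b = sum_list ds"
      proof (cases "a' = a")
        case True
        then show ?thesis using that[of "[]"] by simp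
      next
        case False
        then show ?thesis using a(2)[of a'] \<open>a' \<in> set_pmf s1\<close> that by blast
      qed
      show ?thesis using nash_sums_diff[OF ds(1), of "\<lambda>x y. x = a'"] unfolding ds(2) by blast
    qed
    then obtain K w2 where K: "\<And>a'. a' \<in> set_pmf s1 \<Longrightarrow>
        nash_sums MP u1 u2 (\<lambda>x y. (if x = a' then u1 a b - u1 a' b else 0) + K a') (w2 a')"
      by metis
    \<comment> \<open>In a support row only its own summand departs from the constant, so in column
      \<open>b\<close> all support rows reach \<open>u1 a b\<close> plus the total of the
      constants.\<close>
    have sums: "nash_sums MP u1 u2
        (\<lambda>x y. \<Sum>a'\<in>set_pmf s1. (if x = a' then u1 a b - u1 a' b else 0) + K a')
        (\<lambda>x y. \<Sum>a'\<in>set_pmf s1. w2 a' x y)"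
      by (intro nash_sums_sum K) auto
    show ?thesis
    proof (rule rewardable_player1[OF one(1,2) _ _ _ one(3) sums])
      show "eu (\<lambda>x y. u1 x y + (\<Sum>a'\<in>set_pmf s1. (if x = a' then u1 a b - u1 a' b else 0) + K a'))
          (return_pmf x) (return_pmf b) = u1 a b + (\<Sum>a'\<in>set_pmf s1. K a')"
        if "x \<in> set_pmf s1" for x
        using that by (simp add: sum.distrib)
    qed (use one in \<open>auto simp: avail1_def avail2_def\<close>)
  next
    case two
    then show ?thesis
      by (intro rewardable_player2[where ?s1.0 = s1 and b = b and b' = b']) (auto simp: avail1_def simp del: eu_return)
  qed
qed


subsection \<open>The last locally suboptimal history\<close>

lemma rval_const:
  assumes "\<forall>p\<in>nash r u1 u2. eu u (fst p) (snd p) = v"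
    and "\<And>h'. m \<le> length h' \<Longrightarrow> length h' < T \<Longrightarrow> (f h', g h') \<in> nash r u1 u2"
    and "length h + n = T" "m \<le> length h"
  shows "rval u n f g h = real n * v"
  using assms(3,4)
proof (induction n arbitrary: h)
  case (Suc n)
  have "rval u n f g (h @ [x]) = real n * v" for x
    using Suc.prems by (intro Suc.IH) auto
  moreover have "eu u (f h) (g h) = v"
    using bspec[OF assms(1) assms(2)[of h]] Suc.prems by simp
  ultimately show ?case by (simp add: rval_Suc_eu eu_add algebra_simps del: rval.simps)
qed simp

text \<open>Player 1 is indifferent over the support both in the stage game and in the continuation
  game, so the continuation value can be read off along any single path of play.\<close>

lemma rval_path:
  assumes "r \<noteq> MM" and spe: "spe r u1 u2 T f g"
    and later: "\<And>h'. m \<le> length h' \<Longrightarrow> length h' < T \<Longrightarrow> (f h', g h') \<in> nash r u1 u2"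
    and "length h + n = T" "m \<le> length h"
  shows "\<exists>xs. length xs = n \<and> set xs \<subseteq> V1 r u1 u2 \<and> rval u1 n f g h = sum_list xs"
  using assms(4,5)
proof (induction n arbitrary: h)
  case (Suc n)
  obtain b where b: "g h = return_pmf b"
    using spe \<open>r \<noteq> MM\<close> by (auto simp: spe_def strat2_def avail2_def)
  obtain a where a: "a \<in> set_pmf (f h)" using set_pmf_not_empty[of "f h"] by blast
  have stage: "(f h, g h) \<in> nash r (stage u1 n f g h) (stage u2 n f g h)"
    using spe Suc.prems by (simp add: spe_iff_one_shot)
  have nash: "(f h, g h) \<in> nash r u1 u2" using later Suc.prems by simp
  obtain xs where xs: "length xs = n" "set xs \<subseteq> V1 r u1 u2"
      "rval u1 n f g (h @ [(a, b)]) = sum_list xs"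
    using Suc.IH[of "h @ [(a, b)]"] Suc.prems by auto
  have "rval u1 (Suc n) f g h = u1 a b + sum_list xs"
    using nash_support1[OF stage a] xs by (simp add: rval_Suc_eu b del: rval.simps)
  moreover have "u1 a b = eu u1 (f h) (g h)"
    using nash_support1[OF nash a] by (simp add: b)
  moreover have "eu u1 (f h) (g h) \<in> V1 r u1 u2" using nash by (force simp: V_image)
  ultimately show ?case using xs by (intro exI[of _ "u1 a b # xs"]) auto
qed simp

text \<open>The profile is the play at a longest suboptimal history, and \<open>W1\<close>,
  \<open>W2\<close> are the continuation values there. Only stage equilibria follow, which yields
  the last three conditions.\<close>

lemma GLS_E:
  fixes u1 :: "'a::finite \<Rightarrow> 'b::finite \<Rightarrow> real" and u2 :: "'a \<Rightarrow> 'b \<Rightarrow> real"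
  assumes "GLS r u1 u2"
  obtains s1 s2 W1 W2 n where
    "(s1, s2) \<in> nash r (\<lambda>a b. u1 a b + W1 a b) (\<lambda>a b. u2 a b + W2 a b)"
    "(s1, s2) \<notin> nash r u1 u2"
    "nash r u1 u2 \<noteq> {}"
    "card (V1 r u1 u2) = 1 \<longrightarrow> (\<exists>c. W1 = (\<lambda>a b. c))"
    "card (V2 r u1 u2) = 1 \<longrightarrow> (\<exists>c. W2 = (\<lambda>a b. c))"
    "r \<noteq> MM \<longrightarrow> (\<forall>a b. \<exists>xs. length xs = n \<and> set xs \<subseteq> V1 r u1 u2 \<and> W1 a b = sum_list xs)"
proof -
  obtain T f g h0 where T: "spe r u1 u2 T f g" "length h0 < T" "(f h0, g h0) \<notin> nash r u1 u2"
    using assms unfolding GLS_def by blast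
  let ?bad = "\<lambda>h. length h < T \<and> (f h, g h) \<notin> nash r u1 u2"
  obtain h where h: "?bad h" and max: "\<And>h'. ?bad h' \<Longrightarrow> length h' \<le> length h"
    using ex_has_greatest_nat[of ?bad h0 length T] T by force
  obtain n where n: "length h + Suc n = T"
    using h less_imp_Suc_add[of "length h" T] by auto
  have later: "(f h', g h') \<in> nash r u1 u2" if "Suc (length h) \<le> length h'" "length h' < T" for h'
    using max[of h'] that by fastforce
  have stage: "(f h, g h) \<in> nash r (stage u1 n f g h) (stage u2 n f g h)"
    using T(1) n by (simp add: spe_iff_one_shot)
  \<comment> \<open>The last round has no continuation, so any history of length
    \<open>T - 1\<close>, whatever its entries, exhibits a stage equilibrium.\<close>
  define h1 where "h1 = replicate (T - 1) (undefined :: 'a \<times> 'b)"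
  have "length h1 + Suc 0 = T" using n by (simp add: h1_def)
  then have "(f h1, g h1) \<in> nash r (stage u1 0 f g h1) (stage u2 0 f g h1)"
    using T(1) unfolding spe_iff_one_shot by blast
  then have "nash r u1 u2 \<noteq> {}" by auto
  moreover have "\<exists>c. (\<lambda>a b. rval u1 n f g (h @ [(a, b)])) = (\<lambda>a b. c)" if single: "card (V1 r u1 u2) = 1"
  proof -
    obtain v where v: "\<forall>p\<in>nash r u1 u2. eu u1 (fst p) (snd p) = v"
      by (rule single_V1_E[OF single])
    have "rval u1 n f g (h @ [x]) = real n * v" for x
      using n by (intro rval_const[OF v later]) auto
    then show ?thesis by auto
  qed
  moreover have "\<exists>c. (\<lambda>a b. rval u2 n f g (h @ [(a, b)])) = (\<lambda>a b. c)" if single: "card (V2 r u1 u2) = 1"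
  proof -
    obtain v where v: "\<forall>p\<in>nash r u1 u2. eu u2 (fst p) (snd p) = v"
      by (rule single_V2_E[OF single])
    have "rval u2 n f g (h @ [x]) = real n * v" for x
      using n by (intro rval_const[OF v later]) auto
    then show ?thesis by auto
  qed
  moreover have "\<exists>xs. length xs = n \<and> set xs \<subseteq> V1 r u1 u2 \<and> rval u1 n f g (h @ [(a, b)]) = sum_list xs"
    if "r \<noteq> MM" for a b
    using n by (intro rval_path[OF that T(1) later]) auto
  ultimately show ?thesis
    using that[OF stage] h by blast
qed

section \<open>Necessity of \<open>Cmm\<close> and \<open>Cmp\<close>\<close>

lemma V_empty_iff: "V1 r u1 u2 = {} \<longleftrightarrow> nash r u1 u2 = {}" "V2 r u1 u2 = {} \<longleftrightarrow> nash r u1 u2 = {}"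
  by (auto simp: V_image)

text \<open>A constant reward leaves player 2 best responding in the stage game, so the failure of
  equilibrium lies with player 1.\<close>

lemma not_nash_player1:
  assumes eq: "(s1, s2) \<in> nash r (\<lambda>a b. u1 a b + W a b) (\<lambda>a b. u2 a b + c)"
    and not_eq: "(s1, s2) \<notin> nash r u1 u2"
  shows "\<exists>a'. eu u1 s1 s2 < eu u1 (return_pmf a') s2" "\<forall>t. eu u2 s1 t \<le> eu u2 s1 s2"
proof -
  have best: "\<forall>b. eu u2 s1 (return_pmf b) \<le> eu u2 s1 s2" and "s1 \<in> avail1 r" "s2 \<in> avail2 r"
    using eq by (auto simp: nash_iff_pure eu_add)
  then show "\<exists>a'. eu u1 s1 s2 < eu u1 (return_pmf a') s2"
    using not_eq by (auto simp: nash_iff_pure not_le)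
  show "\<forall>t. eu u2 s1 t \<le> eu u2 s1 s2" by (rule eu_le_iff_pure2[THEN iffD2, OF best])
qed

lemma not_nash_player2:
  assumes eq: "(s1, s2) \<in> nash r (\<lambda>a b. u1 a b + c) (\<lambda>a b. u2 a b + W a b)"
    and not_eq: "(s1, s2) \<notin> nash r u1 u2"
  shows "\<exists>b'. eu u2 s1 s2 < eu u2 s1 (return_pmf b')" "\<forall>t. eu u1 t s2 \<le> eu u1 s1 s2"
proof -
  have best: "\<forall>a. eu u1 (return_pmf a) s2 \<le> eu u1 s1 s2" and "s1 \<in> avail1 r" "s2 \<in> avail2 r"
    using eq by (auto simp: nash_iff_pure eu_add)
  then show "\<exists>b'. eu u2 s1 s2 < eu u2 s1 (return_pmf b')"
    using not_eq by (auto simp: nash_iff_pure not_le)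
  show "\<forall>t. eu u1 t s2 \<le> eu u1 s1 s2" by (rule eu_le_iff_pure1[THEN iffD2, OF best])
qed

lemma GLS_imp_Cmm:
  assumes "GLS MM u1 u2"
  shows "Cmm u1 u2"
proof -
  obtain s1 s2 W1 W2 where
    eq: "(s1, s2) \<in> nash MM (\<lambda>a b. u1 a b + W1 a b) (\<lambda>a b. u2 a b + W2 a b)"
    and not_eq: "(s1, s2) \<notin> nash MM u1 u2" and "nash MM u1 u2 \<noteq> {}"
    and single1: "card (V1 MM u1 u2) = 1 \<longrightarrow> (\<exists>c. W1 = (\<lambda>a b. c))"
    and single2: "card (V2 MM u1 u2) = 1 \<longrightarrow> (\<exists>c. W2 = (\<lambda>a b. c))"
    by (rule GLS_E[OF assms])
  then have ne: "V1 MM u1 u2 \<noteq> {}" "V2 MM u1 u2 \<noteq> {}" by (auto simp: V_empty_iff)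
  show ?thesis
  proof (cases "card (V1 MM u1 u2) = 1"; cases "card (V2 MM u1 u2) = 1")
    \<comment> \<open>Impossible: constant rewards for both players would make the profile a stage
      equilibrium.\<close>
    assume "card (V1 MM u1 u2) = 1" "card (V2 MM u1 u2) = 1"
    then obtain c1 c2 where "W1 = (\<lambda>a b. c1)" "W2 = (\<lambda>a b. c2)" using single1 single2 by blast
    then show ?thesis using eq not_eq by (simp add: nash_add_const)
  next
    assume c: "card (V1 MM u1 u2) = 1" "card (V2 MM u1 u2) \<noteq> 1"
    then obtain c1 where "W1 = (\<lambda>a b. c1)" using single1 by blast
    then show ?thesis
      using not_nash_player2[of s1 s2 MM u1 c1 u2 W2] eq not_eq c ne
      unfolding Cmm_def card_1_iff_not_several by blast
  next
    assume c: "card (V1 MM u1 u2) \<noteq> 1" "card (V2 MM u1 u2) = 1"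
    then obtain c2 where "W2 = (\<lambda>a b. c2)" using single2 by blast
    then show ?thesis
      using not_nash_player1[of s1 s2 MM u1 W1 u2 c2] eq not_eq c ne
      unfolding Cmm_def card_1_iff_not_several by blast
  next
    assume "card (V1 MM u1 u2) \<noteq> 1" "card (V2 MM u1 u2) \<noteq> 1"
    then show ?thesis
      using not_eq ne unfolding Cmm_def card_1_iff_not_several by blast
  qed
qed

text \<open>Equal lengths let the sums be subtracted entry by entry; here the common number of
  remaining rounds enters.\<close>

lemma ex_differences:
  fixes xs ys :: "real list"
  assumes "length xs = length ys" "set xs \<subseteq> V" "set ys \<subseteq> V"
  shows "\<exists>ds. set ds \<subseteq> {x - y | x y. x \<in> V \<and> y \<in> V} \<and> sum_list xs - sum_list ys = sum_list ds"
  using assms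
proof (induction xs ys rule: list_induct2)
  case (Cons x xs y ys)
  then obtain ds where "set ds \<subseteq> {x - y | x y. x \<in> V \<and> y \<in> V}" "sum_list xs - sum_list ys = sum_list ds"
    by auto
  then show ?case using Cons.prems by (intro exI[of _ "(x - y) # ds"]) auto
next
  case Nil
  show ?case by (intro exI[of _ "[]"]) simp
qed

lemma GLS_imp_Cmp:
  assumes "GLS MP u1 u2"
  shows "Cmp u1 u2"
proof -
  let ?D = "{eu u1 (fst p) (snd p) - eu u1 (fst q) (snd q) | p q. p \<in> nash MP u1 u2 \<and> q \<in> nash MP u1 u2}"
  obtain s1 s2 W1 W2 n where
    eq: "(s1, s2) \<in> nash MP (\<lambda>a b. u1 a b + W1 a b) (\<lambda>a b. u2 a b + W2 a b)"
    and not_eq: "(s1, s2) \<notin> nash MP u1 u2" and "nash MP u1 u2 \<noteq> {}"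
    and single1: "card (V1 MP u1 u2) = 1 \<longrightarrow> (\<exists>c. W1 = (\<lambda>a b. c))"
    and single2: "card (V2 MP u1 u2) = 1 \<longrightarrow> (\<exists>c. W2 = (\<lambda>a b. c))"
    and path: "MP \<noteq> MM \<longrightarrow> (\<forall>a b. \<exists>xs. length xs = n \<and> set xs \<subseteq> V1 MP u1 u2 \<and> W1 a b = sum_list xs)"
    by (rule GLS_E[OF assms])
  then have ne: "V1 MP u1 u2 \<noteq> {}" "V2 MP u1 u2 \<noteq> {}" by (auto simp: V_empty_iff)
  obtain b where b: "s2 = return_pmf b" using eq by (auto simp: nash_def avail2_def)
  show ?thesis
  proof (cases "card (V1 MP u1 u2) = 1"; cases "card (V2 MP u1 u2) = 1")
    assume "card (V1 MP u1 u2) = 1" "card (V2 MP u1 u2) = 1"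
    then obtain c1 c2 where "W1 = (\<lambda>a b. c1)" "W2 = (\<lambda>a b. c2)" using single1 single2 by blast
    then show ?thesis using eq not_eq by (simp add: nash_add_const)
  next
    assume c: "card (V1 MP u1 u2) = 1" "card (V2 MP u1 u2) \<noteq> 1"
    then obtain c1 where "W1 = (\<lambda>a b. c1)" using single1 by blast
    then show ?thesis
      using not_nash_player2[of s1 s2 MP u1 c1 u2 W2] eq not_eq c ne
      unfolding Cmp_def card_1_iff_not_several b by blast
  next
    assume c: "card (V1 MP u1 u2) \<noteq> 1" "card (V2 MP u1 u2) = 1"
    then obtain c2 where W2: "W2 = (\<lambda>a b. c2)" using single2 by blast
    \<comment> \<open>Any support action can be the reference, since the continuation values of all
      cells are sums of equally many equilibrium payoffs.\<close>
    obtain a where a: "a \<in> set_pmf s1" using set_pmf_not_empty[of s1] by blast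
    have "{x - y | x y. x \<in> V1 MP u1 u2 \<and> y \<in> V1 MP u1 u2} \<subseteq> ?D"
      unfolding V_image by blast
    moreover have "\<exists>ds. set ds \<subseteq> {x - y | x y. x \<in> V1 MP u1 u2 \<and> y \<in> V1 MP u1 u2} \<and>
        u1 a b - u1 a' b = sum_list ds" if "a' \<in> set_pmf s1" for a'
    proof -
      obtain xs where xs: "length xs = n" "set xs \<subseteq> V1 MP u1 u2" "W1 a b = sum_list xs"
        using path by blast
      obtain ys where ys: "length ys = n" "set ys \<subseteq> V1 MP u1 u2" "W1 a' b = sum_list ys"
        using path by blast
      \<comment> \<open>Both actions are in the support, so a stage difference is offset by the
        opposite difference of continuation values.\<close>
      have "u1 a b + W1 a b = u1 a' b + W1 a' b"
        using nash_support1[OF eq a] nash_support1[OF eq that] by (simp add: b)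
      then have "u1 a b - u1 a' b = sum_list ys - sum_list xs" using xs ys by simp
      then show ?thesis using ex_differences[of ys xs "V1 MP u1 u2"] xs ys by simp
    qed
    ultimately have "\<forall>a'\<in>set_pmf s1 - {a}. \<exists>ds. set ds \<subseteq> ?D \<and> u1 a b - u1 a' b = sum_list ds"
      by (meson DiffD1 order_trans)
    moreover obtain a' where "eu u1 s1 (return_pmf b) < eu u1 (return_pmf a') (return_pmf b)"
      "\<forall>y. eu u2 s1 (return_pmf y) \<le> eu u2 s1 (return_pmf b)"
      using not_nash_player1[of s1 s2 MP u1 W1 u2 c2] eq not_eq unfolding W2 b by blast
    moreover have "several (V1 MP u1 u2)" using c(1) ne(1) card_1_iff_not_several by blast
    ultimately show ?thesis unfolding Cmp_def using c(2) a by blast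
  next
    assume "card (V1 MP u1 u2) \<noteq> 1" "card (V2 MP u1 u2) \<noteq> 1"
    then show ?thesis
      using not_eq ne unfolding Cmp_def card_1_iff_not_several b by blast
  qed
qed

text \<open>Pure equilibria of the two regimes coincide. If all pure profiles are equilibria, no
  deviation ever pays, and each alternative of \<open>Cmm\<close> lacks its witness.\<close>

lemma all_nash_MP_imp_not_Cmm:
  assumes "\<And>s1 b. (s1, return_pmf b) \<in> nash MP u1 u2"
  shows "\<not> Cmm u1 u2"
proof -
  have "(return_pmf a, return_pmf b) \<in> nash MM u1 u2" for a b
    using assms[of "return_pmf a" b] by (auto simp: nash_iff_pure)
  then have all: "(s1, s2) \<in> nash MM u1 u2" for s1 s2
    using ex_non_nash_pure[of s1 s2 MM u1 u2] by (auto simp: avail1_def avail2_def)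
  then have "\<not> eu u1 s1 s2 < eu u1 (return_pmf a) s2" "\<not> eu u2 s1 s2 < eu u2 s1 (return_pmf b)" for s1 s2 a b
    using all[of s1 s2] by (auto simp: nash_iff_pure not_less)
  then show ?thesis using all unfolding Cmm_def by blast
qed

section \<open>Comparison of the mixed-pure and mixed-mixed regimes\<close>

theorem mainTheorem15:
  fixes u1 :: "'a::finite \<Rightarrow> 'b::finite \<Rightarrow> real" and u2 :: "'a \<Rightarrow> 'b \<Rightarrow> real"
  shows "(\<not> GLS MP u1 u2 \<and> GLS MM u1 u2) \<longleftrightarrow>
    ((V1 MP u1 u2 = {} \<and> V2 MP u1 u2 = {} \<and> Cmm u1 u2)
     \<or> (card (V1 MP u1 u2) = 1 \<and> card (V2 MP u1 u2) = 1 \<and> Cmm u1 u2)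
     \<or> (several (V1 MP u1 u2) \<and> card (V2 MP u1 u2) = 1 \<and> \<not> Cmp u1 u2 \<and> Cmm u1 u2)
     \<or> (card (V1 MP u1 u2) = 1 \<and> several (V2 MP u1 u2) \<and> \<not> Cmp u1 u2 \<and> Cmm u1 u2))"
proof -
  have GLS: "GLS MP u1 u2 \<longleftrightarrow> Cmp u1 u2" "GLS MM u1 u2 \<longleftrightarrow> Cmm u1 u2"
    using Cmp_imp_GLS GLS_imp_Cmp Cmm_imp_GLS GLS_imp_Cmm by blast+
  \<comment> \<open>With several payoffs for both players, \<open>Cmp\<close> fails only when every
    profile is an equilibrium, and then \<open>Cmm\<close> fails too; hence this combination is
    absent from the list.\<close>
  have both: "Cmp u1 u2 \<or> \<not> Cmm u1 u2" if "several (V1 MP u1 u2)" "several (V2 MP u1 u2)"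
    using that all_nash_MP_imp_not_Cmm[of u1 u2] unfolding Cmp_def by blast
  have empty: "V1 MP u1 u2 = {} \<longleftrightarrow> V2 MP u1 u2 = {}" by (simp add: V_empty_iff)
  \<comment> \<open>Yields the failure of \<open>Cmp\<close> in the first two cases, which do not
    state it.\<close>
  have Cmp: "several (V1 MP u1 u2) \<or> several (V2 MP u1 u2)" if "Cmp u1 u2"
    using that unfolding Cmp_def by blast
  have nonempty: "V1 MP u1 u2 \<noteq> {}" if "several (V1 MP u1 u2)"
    using that by (auto simp: several_def)
  have nonempty': "V2 MP u1 u2 \<noteq> {}" if "several (V2 MP u1 u2)"
    using that by (auto simp: several_def)
  show ?thesis
    unfolding GLS card_1_iff_not_several using both empty Cmp nonempty nonempty' by argo
qed

end
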